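(* Let $K$ be a field and let $Q$ be a (connected) quiver which is a tree. Let $\mathcal{R}_Q:\mathrm{rep}(Q)\to\mathrm{rep}(Q)$ be the global tensor functor of $Q$. If $V$ is an indecomposable representation of $Q$, then $$\mathcal{R}_QV\neq 0\iff V\cong\mathbf 1_Q .$$ In particular, if $V$ is a representation of $Q$ and we write $V\cong\bigoplus_jV_j$ where the $V_j\subseteq V$ are indecomposable subrepresentations of $V$, then $$\mathcal{R}_QV\cong\bigoplus_{j\,:\,V_j\cong\mathbf 1_Q}V_j .$$
   Context: A quiver $Q=(Q_0,Q_1,t,h)$ has a finite vertex set $Q_0$, a finite arrow set $Q_1$, and tail and head maps $t,h:Q_1\to Q_0$. $Q$ is a tree if its underlying graph is a tree (removing any edge makes it disconnected); edges may be oriented arbitrarily. $\mathrm{rep}(Q)$ is the category of finite dimensional representations of $Q$ over $K$: a representation $V$ consists of finite dimensional $K$-vector spaces $V_x$ ($x\in Q_0$) and linear maps $V_a:V_{ta}\to V_{ha}$ ($a\in Q_1$); a morphism $V\to W$ is a family of linear maps $\varphi_x:V_x\to W_x$ with $\varphi_{ha}\circ V_a=W_a\circ\varphi_{ta}$ for all arrows $a$. The identity representation $\mathbf 1_Q$ has $(\mathbf 1_Q)_x=K$ for every vertex and $(\mathbf 1_Q)_a=\mathrm{id}_K$ for every arrow. A representation $V$ is called epimorphic (resp. monomorphic) if $V_a$ is surjective (resp. injective) for every arrow $a$. Every $V\in\mathrm{rep}(Q)$ has a unique maximal epimorphic subrepresentation $\mathcal{E}_Q(V)\subseteq V$ (the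 sum of all epimorphic subrepresentations) and a unique maximal monomorphic quotient $V\twoheadrightarrow\mathcal{M}_Q(V)$ (every monomorphic quotient of $V$ is a quotient of $\mathcal{M}_Q(V)$ compatibly with the maps from $V$). Both $\mathcal{E}_Q$ and $\mathcal{M}_Q$ are functors $\mathrm{rep}(Q)\to\mathrm{rep}(Q)$, and the composition $\mathcal{E}_Q(V)\hookrightarrow V\twoheadrightarrow\mathcal{M}_Q(V)$ is a natural transformation $\Phi:\mathcal{E}_Q\to\mathcal{M}_Q$. The global tensor functor of $Q$ is the image functor $\mathcal{R}_Q:=\mathrm{im}(\Phi)$, i.e. $\mathcal{R}_QV=\mathrm{im}(\mathcal{E}_Q(V)\to\mathcal{M}_Q(V))$. *)

theory Defs
  imports
    "Graph_Theory.Graph_Theory"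
    "HOL-Algebra.AbelCoset"
    "Jordan_Normal_Form.Missing_VectorSpace"
begin

section \<open>Tree quivers\<close>

text \<open>
  A quiver is a finite directed multigraph (\<^locale>\<open>fin_digraph\<close>), loops and parallel arrows
  allowed.  \<^const>\<open>connected\<close> is connectedness of the underlying undirected graph.  The constant
  \<open>Digraph_Component.tree\<close> is not suitable: it only forbids directed cycles, hence admits, e.g.,
  two parallel arrows.
\<close>

definition tree_quiver :: "('q, 'e) pre_digraph \<Rightarrow> bool" where
  "tree_quiver Q \<longleftrightarrow>
     connected Q \<and> (\<forall>a \<in> arcs Q. \<not> connected (pre_digraph.del_arc Q a))"


section \<open>Representations\<close>

text \<open>
  The spaces at the vertices are records with their own carrier and operations; sharing the
  element type \<open>'v\<close> does not relate them.  Values of \<open>vspace\<close> off \<open>verts Q\<close>, of \<open>vmap\<close> off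
  \<open>arcs Q\<close>, and of \<open>vmap a\<close> off the carrier of its source are irrelevant.
\<close>

record ('q, 'e, 'k, 'v) quiver_rep =
  vspace :: "'q \<Rightarrow> ('k, 'v) module"
  vmap :: "'e \<Rightarrow> 'v \<Rightarrow> 'v"

definition is_rep ::
  "('k, 'm) ring_scheme \<Rightarrow> ('q, 'e) pre_digraph \<Rightarrow> ('q, 'e, 'k, 'v) quiver_rep \<Rightarrow> bool" where
  "is_rep K Q V \<longleftrightarrow>
     (\<forall>x \<in> verts Q. vectorspace K (vspace V x) \<and> vectorspace.fin_dim K (vspace V x)) \<and>
     (\<forall>a \<in> arcs Q. linear_map K (vspace V (tail Q a)) (vspace V (head Q a)) (vmap V a))"

definition rep_hom ::
  "('k, 'm) ring_scheme \<Rightarrow> ('q, 'e) pre_digraph \<Rightarrow> ('q, 'e, 'k, 'v) quiver_rep \<Rightarrow>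
   ('q, 'e, 'k, 'w) quiver_rep \<Rightarrow> ('q \<Rightarrow> 'v \<Rightarrow> 'w) \<Rightarrow> bool" where
  "rep_hom K Q V W \<phi> \<longleftrightarrow>
     (\<forall>x \<in> verts Q. linear_map K (vspace V x) (vspace W x) (\<phi> x)) \<and>
     (\<forall>a \<in> arcs Q. \<forall>v \<in> carrier (vspace V (tail Q a)).
        \<phi> (head Q a) (vmap V a v) = vmap W a (\<phi> (tail Q a) v))"

definition rep_iso ::
  "('k, 'm) ring_scheme \<Rightarrow> ('q, 'e) pre_digraph \<Rightarrow> ('q, 'e, 'k, 'v) quiver_rep \<Rightarrow>
   ('q, 'e, 'k, 'w) quiver_rep \<Rightarrow> bool" where
  "rep_iso K Q V W \<longleftrightarrow>
     (\<exists>\<phi>. rep_hom K Q V W \<phi> \<and>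
          (\<forall>x \<in> verts Q. bij_betw (\<phi> x) (carrier (vspace V x)) (carrier (vspace W x))))"

definition zero_rep :: "('q, 'e) pre_digraph \<Rightarrow> ('q, 'e, 'k, 'v) quiver_rep \<Rightarrow> bool" where
  "zero_rep Q V \<longleftrightarrow> (\<forall>x \<in> verts Q. carrier (vspace V x) = {\<zero>\<^bsub>vspace V x\<^esub>})"

definition identity_rep :: "('k, 'm) ring_scheme \<Rightarrow> ('q, 'e, 'k, 'k) quiver_rep" where
  "identity_rep K =
     \<lparr>vspace = (\<lambda>x. \<lparr>carrier = carrier K, monoid.mult = monoid.mult K, one = one K,
                     zero = zero K, add = add K, smult = monoid.mult K\<rparr>),
      vmap = (\<lambda>a v. v)\<rparr>"

definition epimorphic_rep :: "('q, 'e) pre_digraph \<Rightarrow> ('q, 'e, 'k, 'v) quiver_rep \<Rightarrow> bool" where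
  "epimorphic_rep Q V \<longleftrightarrow>
     (\<forall>a \<in> arcs Q. vmap V a ` carrier (vspace V (tail Q a)) = carrier (vspace V (head Q a)))"

definition monomorphic_rep :: "('q, 'e) pre_digraph \<Rightarrow> ('q, 'e, 'k, 'v) quiver_rep \<Rightarrow> bool" where
  "monomorphic_rep Q V \<longleftrightarrow> (\<forall>a \<in> arcs Q. inj_on (vmap V a) (carrier (vspace V (tail Q a))))"


section \<open>Subrepresentations and quotients\<close>

text \<open>A subrepresentation is given by its family of subspaces.\<close>

definition is_subrep ::
  "('k, 'm) ring_scheme \<Rightarrow> ('q, 'e) pre_digraph \<Rightarrow> ('q, 'e, 'k, 'v) quiver_rep \<Rightarrow>
   ('q \<Rightarrow> 'v set) \<Rightarrow> bool" where
  "is_subrep K Q V S \<longleftrightarrow>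
     (\<forall>x \<in> verts Q. subspace K (S x) (vspace V x)) \<and>
     (\<forall>a \<in> arcs Q. vmap V a ` S (tail Q a) \<subseteq> S (head Q a))"

definition sub_rep ::
  "('q, 'e, 'k, 'v) quiver_rep \<Rightarrow> ('q \<Rightarrow> 'v set) \<Rightarrow> ('q, 'e, 'k, 'v) quiver_rep" where
  "sub_rep V S = V\<lparr>vspace := (\<lambda>x. (vspace V x)\<lparr>carrier := S x\<rparr>)\<rparr>"

text \<open>
  The elements of a quotient space are cosets.  As in \<^const>\<open>direct_sum\<close>, the fields \<open>mult\<close> and
  \<open>one\<close>, which the \<open>module\<close> record inherits from \<open>ring\<close>, carry no information.
\<close>

definition quot_space :: "('k, 'v) module \<Rightarrow> 'v set \<Rightarrow> ('k, 'v set) module" where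
  "quot_space M N =
     \<lparr>carrier = a_rcosets\<^bsub>M\<^esub> N, monoid.mult = (\<lambda>A B. N), one = N,
      zero = N, add = set_add M,
      smult = (\<lambda>c A. \<Union>v \<in> A. N +>\<^bsub>M\<^esub> (c \<odot>\<^bsub>M\<^esub> v))\<rparr>"

definition quot_proj ::
  "('q, 'e, 'k, 'v) quiver_rep \<Rightarrow> ('q \<Rightarrow> 'v set) \<Rightarrow> 'q \<Rightarrow> 'v \<Rightarrow> 'v set" where
  "quot_proj V N x v = N x +>\<^bsub>vspace V x\<^esub> v"

definition quot_rep ::
  "('q, 'e) pre_digraph \<Rightarrow> ('q, 'e, 'k, 'v) quiver_rep \<Rightarrow> ('q \<Rightarrow> 'v set) \<Rightarrow>
   ('q, 'e, 'k, 'v set) quiver_rep" where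
  "quot_rep Q V N =
     \<lparr>vspace = (\<lambda>x. quot_space (vspace V x) (N x)),
      vmap = (\<lambda>a A. \<Union>v \<in> A. quot_proj V N (head Q a) (vmap V a v))\<rparr>"


section \<open>Direct sums and indecomposability\<close>

text \<open>This is the external direct sum only if \<open>J\<close> is finite (otherwise it is the product).\<close>

definition dsum_space :: "'j set \<Rightarrow> ('j \<Rightarrow> ('k, 'v) module) \<Rightarrow> ('k, 'j \<Rightarrow> 'v) module" where
  "dsum_space J M =
     \<lparr>carrier = (\<Pi>\<^sub>E j \<in> J. carrier (M j)),
      monoid.mult = (\<lambda>f g. \<lambda>j\<in>J. \<zero>\<^bsub>M j\<^esub>), one = (\<lambda>j\<in>J. \<zero>\<^bsub>M j\<^esub>),
      zero = (\<lambda>j\<in>J. \<zero>\<^bsub>M j\<^esub>),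
      add = (\<lambda>f g. \<lambda>j\<in>J. f j \<oplus>\<^bsub>M j\<^esub> g j),
      smult = (\<lambda>c f. \<lambda>j\<in>J. c \<odot>\<^bsub>M j\<^esub> f j)\<rparr>"

definition dsum_rep ::
  "'j set \<Rightarrow> ('j \<Rightarrow> ('q, 'e, 'k, 'v) quiver_rep) \<Rightarrow> ('q, 'e, 'k, 'j \<Rightarrow> 'v) quiver_rep" where
  "dsum_rep J F =
     \<lparr>vspace = (\<lambda>x. dsum_space J (\<lambda>j. vspace (F j) x)),
      vmap = (\<lambda>a f. \<lambda>j\<in>J. vmap (F j) a (f j))\<rparr>"

definition indecomposable_rep ::
  "('k, 'm) ring_scheme \<Rightarrow> ('q, 'e) pre_digraph \<Rightarrow> ('q, 'e, 'k, 'v) quiver_rep \<Rightarrow> bool" where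
  "indecomposable_rep K Q V \<longleftrightarrow>
     is_rep K Q V \<and> \<not> zero_rep Q V \<and>
     (\<forall>S T. is_subrep K Q V S \<and> is_subrep K Q V T \<and>
        (\<forall>x \<in> verts Q. module.submodule_sum (vspace V x) (S x) (T x) = carrier (vspace V x) \<and>
                        S x \<inter> T x = {\<zero>\<^bsub>vspace V x\<^esub>}) \<longrightarrow>
        zero_rep Q (sub_rep V S) \<or> zero_rep Q (sub_rep V T))"


section \<open>The global tensor functor\<close>

definition epi_part ::
  "('k, 'm) ring_scheme \<Rightarrow> ('q, 'e) pre_digraph \<Rightarrow> ('q, 'e, 'k, 'v) quiver_rep \<Rightarrow>
   'q \<Rightarrow> 'v set" where
  "epi_part K Q V x =
     module.span K (vspace V x)
       (\<Union>{S x | S. is_subrep K Q V S \<and> epimorphic_rep Q (sub_rep V S)})"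

text \<open>
  Quotients of \<open>V\<close> correspond to subrepresentations (their kernels), larger quotients having
  smaller kernels: the kernel of the maximal monomorphic quotient is the intersection of the
  kernels of all monomorphic quotients.  Its universal property is \<open>mono_quot_universal\<close> below.
\<close>

definition mono_kernel ::
  "('k, 'm) ring_scheme \<Rightarrow> ('q, 'e) pre_digraph \<Rightarrow> ('q, 'e, 'k, 'v) quiver_rep \<Rightarrow>
   'q \<Rightarrow> 'v set" where
  "mono_kernel K Q V x =
     \<Inter>{N x | N. is_subrep K Q V N \<and> monomorphic_rep Q (quot_rep Q V N)}"

definition mono_quot ::
  "('k, 'm) ring_scheme \<Rightarrow> ('q, 'e) pre_digraph \<Rightarrow> ('q, 'e, 'k, 'v) quiver_rep \<Rightarrow>
   ('q, 'e, 'k, 'v set) quiver_rep" where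
  "mono_quot K Q V = quot_rep Q V (mono_kernel K Q V)"

definition global_tensor ::
  "('k, 'm) ring_scheme \<Rightarrow> ('q, 'e) pre_digraph \<Rightarrow> ('q, 'e, 'k, 'v) quiver_rep \<Rightarrow>
   ('q, 'e, 'k, 'v set) quiver_rep" where
  "global_tensor K Q V =
     sub_rep (mono_quot K Q V)
       (\<lambda>x. quot_proj V (mono_kernel K Q V) x ` epi_part K Q V x)"


section \<open>The extremal properties of the two parts\<close>

text \<open>
  \<open>epi_part_greatest\<close> and \<open>mono_quot_universal\<close> show that the sum and the intersection above are the
  maximal epimorphic subrepresentation and the maximal monomorphic quotient, and
  \<open>global_tensor_subrep\<close> that the image is a subrepresentation of the latter.
\<close>

lemma vectorspace_surj:
  assumes V: "vectorspace K V" and c: "carrier W = f ` carrier V"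
    and z: "\<zero>\<^bsub>W\<^esub> = f \<zero>\<^bsub>V\<^esub>"
    and a: "\<And>v w. v \<in> carrier V \<Longrightarrow> w \<in> carrier V \<Longrightarrow> f (v \<oplus>\<^bsub>V\<^esub> w) = f v \<oplus>\<^bsub>W\<^esub> f w"
    and s: "\<And>k v. k \<in> carrier K \<Longrightarrow> v \<in> carrier V \<Longrightarrow> f (k \<odot>\<^bsub>V\<^esub> v) = k \<odot>\<^bsub>W\<^esub> f v"
  shows "vectorspace K W" "linear_map K V W f"
proof -
  interpret V: vectorspace K V by fact
  show W: "vectorspace K W"
  proof (rule vs_criteria)
    show "field K" ..
    show "\<zero>\<^bsub>W\<^esub> \<in> carrier W" by (auto simp: c z)
    show "\<forall>v w. v \<in> carrier W \<and> w \<in> carrier W \<longrightarrow> v \<oplus>\<^bsub>W\<^esub> w \<in> carrier W"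
      by (auto simp: c a[symmetric])
    show "\<forall>v\<in>carrier W. \<exists>n\<in>carrier W. v \<oplus>\<^bsub>W\<^esub> n = \<zero>\<^bsub>W\<^esub>"
    proof
      fix v assume "v \<in> carrier W"
      then obtain u where u: "u \<in> carrier V" "v = f u" by (auto simp: c)
      then have "v \<oplus>\<^bsub>W\<^esub> f (\<ominus>\<^bsub>V\<^esub> u) = \<zero>\<^bsub>W\<^esub>" by (simp add: a[symmetric] z V.M.r_neg)
      then show "\<exists>n\<in>carrier W. v \<oplus>\<^bsub>W\<^esub> n = \<zero>\<^bsub>W\<^esub>" using u by (auto simp: c)
    qed
    show "\<forall>k v. k \<in> carrier K \<and> v \<in> carrier W \<longrightarrow> k \<odot>\<^bsub>W\<^esub> v \<in> carrier W"
      by (auto simp: c s[symmetric])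
    show "\<forall>v w. v \<in> carrier W \<and> w \<in> carrier W \<longrightarrow> v \<oplus>\<^bsub>W\<^esub> w = w \<oplus>\<^bsub>W\<^esub> v"
      by (auto simp: c a[symmetric] V.M.a_comm)
    show "\<forall>v w x. v \<in> carrier W \<and> w \<in> carrier W \<and> x \<in> carrier W \<longrightarrow>
        v \<oplus>\<^bsub>W\<^esub> w \<oplus>\<^bsub>W\<^esub> x = v \<oplus>\<^bsub>W\<^esub> (w \<oplus>\<^bsub>W\<^esub> x)"
      by (auto simp: c a[symmetric] V.M.a_assoc)
    show "\<forall>v\<in>carrier W. v \<oplus>\<^bsub>W\<^esub> \<zero>\<^bsub>W\<^esub> = v"
      by (auto simp: c z a[symmetric])
    show "\<forall>k l v. k \<in> carrier K \<and> l \<in> carrier K \<and> v \<in> carrier W \<longrightarrow>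
        k \<otimes>\<^bsub>K\<^esub> l \<odot>\<^bsub>W\<^esub> v = k \<odot>\<^bsub>W\<^esub> (l \<odot>\<^bsub>W\<^esub> v)"
      by (auto simp: c s[symmetric] V.smult_assoc1)
    show "\<forall>v\<in>carrier W. \<one>\<^bsub>K\<^esub> \<odot>\<^bsub>W\<^esub> v = v"
      by (auto simp: c s[symmetric])
    show "\<forall>k l v. k \<in> carrier K \<and> l \<in> carrier K \<and> v \<in> carrier W \<longrightarrow>
        (k \<oplus>\<^bsub>K\<^esub> l) \<odot>\<^bsub>W\<^esub> v = k \<odot>\<^bsub>W\<^esub> v \<oplus>\<^bsub>W\<^esub> l \<odot>\<^bsub>W\<^esub> v"
      by (auto simp: c s[symmetric] a[symmetric] V.smult_l_distr)
    show "\<forall>k v w. k \<in> carrier K \<and> v \<in> carrier W \<and> w \<in> carrier W \<longrightarrow>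
        k \<odot>\<^bsub>W\<^esub> (v \<oplus>\<^bsub>W\<^esub> w) = k \<odot>\<^bsub>W\<^esub> v \<oplus>\<^bsub>W\<^esub> k \<odot>\<^bsub>W\<^esub> w"
      by (auto simp: c s[symmetric] a[symmetric] V.smult_r_distr)
  qed
  interpret W: vectorspace K W by fact
  show "linear_map K V W f"
    by unfold_locales (simp add: module_hom_def c a s)
qed

lemma subspaceI:
  assumes "vectorspace K M" "S \<subseteq> carrier M" "\<zero>\<^bsub>M\<^esub> \<in> S"
    "\<And>v w. v \<in> S \<Longrightarrow> w \<in> S \<Longrightarrow> v \<oplus>\<^bsub>M\<^esub> w \<in> S"
    "\<And>k v. k \<in> carrier K \<Longrightarrow> v \<in> S \<Longrightarrow> k \<odot>\<^bsub>M\<^esub> v \<in> S"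
  shows "subspace K S M"
  using assms unfolding VectorSpace.subspace_def LinearCombinations.submodule_def vectorspace_def
  by blast

lemma subspaceD:
  assumes "subspace K S M"
  shows "vectorspace K M" "S \<subseteq> carrier M" "\<zero>\<^bsub>M\<^esub> \<in> S"
    "\<And>v w. v \<in> S \<Longrightarrow> w \<in> S \<Longrightarrow> v \<oplus>\<^bsub>M\<^esub> w \<in> S"
    "\<And>k v. k \<in> carrier K \<Longrightarrow> v \<in> S \<Longrightarrow> k \<odot>\<^bsub>M\<^esub> v \<in> S"
  using assms unfolding VectorSpace.subspace_def LinearCombinations.submodule_def
  by blast+

context
  fixes K :: "('k,'m) ring_scheme" and M :: "('k,'v) module" and N
  assumes N: "subspace K N M"
begin

interpretation M: vectorspace K M using N by (simp add: VectorSpace.subspace_def)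

lemma sub_abelian: "abelian_subgroup N M"
proof (rule abelian_subgroupI3)
  note S = subspaceD[OF N]
  have inv: "\<ominus>\<^bsub>M\<^esub> v \<in> N" if v: "v \<in> N" for v
    using S(5)[OF M.R.add.inv_closed[OF M.R.one_closed] v] M.smult_minus_1[of v] S(2) v
    by (simp add: a_inv_def subsetD)
  have "subgroup N (add_monoid M)"
    by (rule M.M.add.subgroupI) (use S(2-4) inv in \<open>auto simp: a_inv_def\<close>)
  then show "additive_subgroup N M" by (rule additive_subgroup.intro)
  show "abelian_group M" ..
qed

interpretation N: abelian_subgroup N M by (rule sub_abelian)


lemma coset_eq_iff:
  assumes v: "v \<in> carrier M" and w: "w \<in> carrier M"
  shows "N +>\<^bsub>M\<^esub> v = N +>\<^bsub>M\<^esub> w \<longleftrightarrow> v \<ominus>\<^bsub>M\<^esub> w \<in> N"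
proof -
  have "N +>\<^bsub>M\<^esub> v = N +>\<^bsub>M\<^esub> w \<longleftrightarrow> v \<in> N +>\<^bsub>M\<^esub> w"
    using v w N.a_rcos_self N.a_repr_independence' by metis
  also have "\<dots> \<longleftrightarrow> v \<ominus>\<^bsub>M\<^esub> w \<in> N"
    using N.a_rcos_module[OF w v] by (simp add: M.M.minus_eq)
  finally show ?thesis .
qed

lemma coset_memD:
  assumes v: "v \<in> carrier M" and u: "u \<in> N +>\<^bsub>M\<^esub> v"
  shows "u \<in> carrier M" "N +>\<^bsub>M\<^esub> u = N +>\<^bsub>M\<^esub> v"
  using M.M.a_r_coset_subset_G[OF N.a_subset v] u N.a_repr_independence'[OF u v] by auto

lemma coset_UN:
  assumes v: "v \<in> carrier M" and g: "\<And>u. u \<in> N +>\<^bsub>M\<^esub> v \<Longrightarrow> g u = g v"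
  shows "(\<Union>u \<in> N +>\<^bsub>M\<^esub> v. g u) = g v"
  using N.a_rcos_self[OF v] g by blast

lemma quot_smult:
  assumes v: "v \<in> carrier M" and k: "k \<in> carrier K"
  shows "k \<odot>\<^bsub>quot_space M N\<^esub> (N +>\<^bsub>M\<^esub> v) = N +>\<^bsub>M\<^esub> (k \<odot>\<^bsub>M\<^esub> v)"
proof -
  have "N +>\<^bsub>M\<^esub> (k \<odot>\<^bsub>M\<^esub> u) = N +>\<^bsub>M\<^esub> (k \<odot>\<^bsub>M\<^esub> v)" if u: "u \<in> N +>\<^bsub>M\<^esub> v" for u
  proof -
    have uc: "u \<in> carrier M" and e: "N +>\<^bsub>M\<^esub> u = N +>\<^bsub>M\<^esub> v" using coset_memD[OF v u] by auto
    have "u \<ominus>\<^bsub>M\<^esub> v \<in> N" using e coset_eq_iff[OF uc v] by simp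
    then have "k \<odot>\<^bsub>M\<^esub> (u \<ominus>\<^bsub>M\<^esub> v) \<in> N"
      by (rule subspaceD(5)[OF N k])
    moreover have "k \<odot>\<^bsub>M\<^esub> (u \<ominus>\<^bsub>M\<^esub> v) = k \<odot>\<^bsub>M\<^esub> u \<ominus>\<^bsub>M\<^esub> k \<odot>\<^bsub>M\<^esub> v"
      using k v uc by (simp add: M.M.minus_eq M.smult_r_distr M.smult_r_minus)
    ultimately show ?thesis using coset_eq_iff k v uc by simp
  qed
  from coset_UN[of v "\<lambda>u. N +>\<^bsub>M\<^esub> (k \<odot>\<^bsub>M\<^esub> u)", OF v this]
  show ?thesis by (simp add: quot_space_def)
qed

lemma quot_linear:
  shows "vectorspace K (quot_space M N)"
    and "linear_map K M (quot_space M N) (\<lambda>v. N +>\<^bsub>M\<^esub> v)"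
    and "(\<lambda>v. N +>\<^bsub>M\<^esub> v) ` carrier M = carrier (quot_space M N)"
proof -
  have V: "vectorspace K M" ..
  show c: "(\<lambda>v. N +>\<^bsub>M\<^esub> v) ` carrier M = carrier (quot_space M N)"
    by (auto simp: quot_space_def A_RCOSETS_def')
  have z: "\<zero>\<^bsub>quot_space M N\<^esub> = N +>\<^bsub>M\<^esub> \<zero>\<^bsub>M\<^esub>"
    using M.M.a_coset_add_zero[OF N.a_subset] by (simp add: quot_space_def)
  have a: "N +>\<^bsub>M\<^esub> (v \<oplus>\<^bsub>M\<^esub> w) = (N +>\<^bsub>M\<^esub> v) \<oplus>\<^bsub>quot_space M N\<^esub> (N +>\<^bsub>M\<^esub> w)"
    if "v \<in> carrier M" "w \<in> carrier M" for v w
    using N.a_rcos_sum[OF that] by (simp add: quot_space_def)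
  note * = vectorspace_surj[where f = "\<lambda>v. N +>\<^bsub>M\<^esub> v", OF V c[symmetric] z a]
  show "vectorspace K (quot_space M N)" by (rule *) (simp_all add: quot_smult)
  show "linear_map K M (quot_space M N) (\<lambda>v. N +>\<^bsub>M\<^esub> v)" by (rule *) (simp_all add: quot_smult)
qed

end

lemma image_subspace:
  assumes T: "linear_map K V W T" and S: "subspace K S V"
  shows "subspace K (T ` S) W"
proof -
  interpret linear_map K V W T by fact
  note S = subspaceD[OF S]
  show ?thesis
  proof (rule subspaceI)
    show "vectorspace K W" ..
    show "T ` S \<subseteq> carrier W" using S(2) by auto
    show "\<zero>\<^bsub>W\<^esub> \<in> T ` S" using S(3) T0_is_0 by force
    fix v w assume "v \<in> T ` S" "w \<in> T ` S"
    then obtain v' w' where *: "v' \<in> S" "v = T v'" "w' \<in> S" "w = T w'" by auto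
    then have "v \<oplus>\<^bsub>W\<^esub> w = T (v' \<oplus>\<^bsub>V\<^esub> w')" using S(2) by (simp add: subsetD)
    then show "v \<oplus>\<^bsub>W\<^esub> w \<in> T ` S" using * S(4) by blast
  next
    fix k v assume k: "k \<in> carrier K" and "v \<in> T ` S"
    then obtain v' where *: "v' \<in> S" "v = T v'" by auto
    then have "k \<odot>\<^bsub>W\<^esub> v = T (k \<odot>\<^bsub>V\<^esub> v')" using S(2) k by (simp add: subsetD)
    then show "k \<odot>\<^bsub>W\<^esub> v \<in> T ` S" using * k S(5) by blast
  qed
qed

lemma preimage_subspace:
  assumes T: "linear_map K V W T" and S: "subspace K S W"
  shows "subspace K {v \<in> carrier V. T v \<in> S} V"
proof -
  interpret linear_map K V W T by fact
  note S = subspaceD[OF S]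
  show ?thesis by (rule subspaceI) (simp_all add: V.vectorspace_axioms S subset_iff)
qed

lemma image_span:
  assumes T: "linear_map K V W T" and U: "U \<subseteq> carrier V"
  shows "T ` LinearCombinations.module.span K V U = LinearCombinations.module.span K W (T ` U)"
proof -
  interpret linear_map K V W T by fact
  let ?sV = "LinearCombinations.module.span K V" and ?sW = "LinearCombinations.module.span K W"
  have vV: "vectorspace K V" and vW: "vectorspace K W" by unfold_locales
  note mV = vectorspace.axioms(1)[OF vV] and mW = vectorspace.axioms(1)[OF vW]
  have TU: "T ` U \<subseteq> carrier W" using U by auto
  have sV: "subspace K (?sV U) V" by (rule vectorspace.span_is_subspace[OF vV U])
  have sW: "subspace K (?sW (T ` U)) W" by (rule vectorspace.span_is_subspace[OF vW TU])
  show "T ` ?sV U = ?sW (T ` U)"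
  proof
    have "U \<subseteq> {v \<in> carrier V. T v \<in> ?sW (T ` U)}"
      using U LinearCombinations.module.in_own_span[OF mW TU] by blast
    moreover have "submodule K {v \<in> carrier V. T v \<in> ?sW (T ` U)} V"
      using preimage_subspace[OF T sW] by (simp add: VectorSpace.subspace_def)
    ultimately have "?sV U \<subseteq> {v \<in> carrier V. T v \<in> ?sW (T ` U)}"
      by (rule LinearCombinations.module.span_is_subset[OF mV])
    then show "T ` ?sV U \<subseteq> ?sW (T ` U)" by blast
    have "T ` U \<subseteq> T ` ?sV U" using LinearCombinations.module.in_own_span[OF mV U] by blast
    moreover have "submodule K (T ` ?sV U) W"
      using image_subspace[OF T sV] by (simp add: VectorSpace.subspace_def)
    ultimately show "?sW (T ` U) \<subseteq> T ` ?sV U" by (rule LinearCombinations.module.span_is_subset[OF mW])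
  qed
qed

lemma vs_minus:
  assumes "vectorspace K M" and "v \<in> carrier M"
  shows "v \<ominus>\<^bsub>M\<^esub> \<zero>\<^bsub>M\<^esub> = v"
    and "w \<in> carrier M \<Longrightarrow> v \<ominus>\<^bsub>M\<^esub> w \<in> carrier M"
    and "w \<in> carrier M \<Longrightarrow> v \<ominus>\<^bsub>M\<^esub> w = \<zero>\<^bsub>M\<^esub> \<Longrightarrow> v = w"
proof -
  interpret vectorspace K M by fact
  show "v \<ominus>\<^bsub>M\<^esub> \<zero>\<^bsub>M\<^esub> = v" using assms(2) by (simp add: M.minus_eq)
  show "w \<in> carrier M \<Longrightarrow> v \<ominus>\<^bsub>M\<^esub> w \<in> carrier M" using assms(2) by simp
  show "w \<in> carrier M \<Longrightarrow> v \<ominus>\<^bsub>M\<^esub> w = \<zero>\<^bsub>M\<^esub> \<Longrightarrow> v = w" using assms(2) by simp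
qed

lemma epi_part_greatest:
  assumes V: "is_rep K Q V" and Q: "fin_digraph Q"
  shows "is_subrep K Q V (epi_part K Q V)"
    and "epimorphic_rep Q (sub_rep V (epi_part K Q V))"
    and "is_subrep K Q V S \<Longrightarrow> epimorphic_rep Q (sub_rep V S) \<Longrightarrow> x \<in> verts Q
           \<Longrightarrow> S x \<subseteq> epi_part K Q V x"
proof -
  interpret Q: fin_digraph Q by fact
  let ?U = "\<lambda>x. \<Union>{S x | S. is_subrep K Q V S \<and> epimorphic_rep Q (sub_rep V S)}"
  have vs: "vectorspace K (vspace V x)" if "x \<in> verts Q" for x
    using V that by (simp add: is_rep_def)
  have lin: "linear_map K (vspace V (tail Q a)) (vspace V (head Q a)) (vmap V a)"
    if "a \<in> arcs Q" for a
    using V that by (simp add: is_rep_def)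
  have U: "?U x \<subseteq> carrier (vspace V x)" if "x \<in> verts Q" for x
    using that unfolding is_subrep_def VectorSpace.subspace_def LinearCombinations.submodule_def
    by blast
  have UU: "vmap V a ` ?U (tail Q a) = ?U (head Q a)" if a: "a \<in> arcs Q" for a
  proof -
    have "vmap V a ` S (tail Q a) = S (head Q a)" if "epimorphic_rep Q (sub_rep V S)" for S
      using that a by (simp add: epimorphic_rep_def sub_rep_def)
    then show ?thesis by blast
  qed
  have sp: "epi_part K Q V x = LinearCombinations.module.span K (vspace V x) (?U x)" for x
    by (simp add: epi_part_def)
  have im: "vmap V a ` epi_part K Q V (tail Q a) = epi_part K Q V (head Q a)"
    if a: "a \<in> arcs Q" for a
  proof -
    interpret linear_map K "vspace V (tail Q a)" "vspace V (head Q a)" "vmap V a"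
      using lin[OF a] .
    have "tail Q a \<in> verts Q" using a by simp
    from image_span[OF lin[OF a] U[OF this]] show ?thesis
      by (simp only: sp UU[OF a])
  qed
  have sub: "subspace K (epi_part K Q V x) (vspace V x)" if "x \<in> verts Q" for x
    unfolding sp using vectorspace.span_is_subspace[OF vs[OF that] U[OF that]] .
  show "is_subrep K Q V (epi_part K Q V)" using sub im by (auto simp: is_subrep_def)
  show "epimorphic_rep Q (sub_rep V (epi_part K Q V))"
    using im by (auto simp: epimorphic_rep_def sub_rep_def)
  show "S x \<subseteq> epi_part K Q V x"
    if "is_subrep K Q V S" "epimorphic_rep Q (sub_rep V S)" "x \<in> verts Q"
  proof -
    interpret vectorspace K "vspace V x" using vs that by simp
    have "S x \<subseteq> ?U x" using that by blast
    also have "\<dots> \<subseteq> epi_part K Q V x" unfolding sp using in_own_span[OF U[OF that(3)]] .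
    finally show ?thesis .
  qed
qed


lemma quot_map_coset:
  assumes V: "is_rep K Q V" and Q: "fin_digraph Q" and N: "is_subrep K Q V N"
    and a: "a \<in> arcs Q" and v: "v \<in> carrier (vspace V (tail Q a))"
  shows "vmap (quot_rep Q V N) a (quot_proj V N (tail Q a) v) = quot_proj V N (head Q a) (vmap V a v)"
proof -
  interpret Q: fin_digraph Q by fact
  interpret linear_map K "vspace V (tail Q a)" "vspace V (head Q a)" "vmap V a"
    using V a by (simp add: is_rep_def)
  have Nt: "subspace K (N (tail Q a)) (vspace V (tail Q a))"
    and Nh: "subspace K (N (head Q a)) (vspace V (head Q a))"
    and Na: "vmap V a ` N (tail Q a) \<subseteq> N (head Q a)"
    using N a by (auto simp: is_subrep_def)
  have "quot_proj V N (head Q a) (vmap V a u) = quot_proj V N (head Q a) (vmap V a v)"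
    if u: "u \<in> quot_proj V N (tail Q a) v" for u
  proof -
    have uc: "u \<in> carrier (vspace V (tail Q a))"
      and e: "N (tail Q a) +>\<^bsub>vspace V (tail Q a)\<^esub> u = N (tail Q a) +>\<^bsub>vspace V (tail Q a)\<^esub> v"
      using coset_memD[OF Nt v] u by (auto simp: quot_proj_def)
    have "u \<ominus>\<^bsub>vspace V (tail Q a)\<^esub> v \<in> N (tail Q a)" using coset_eq_iff[OF Nt uc v] e by simp
    then have "vmap V a u \<ominus>\<^bsub>vspace V (head Q a)\<^esub> vmap V a v \<in> N (head Q a)"
      using Na T_minus[OF uc v] by auto
    then show ?thesis using coset_eq_iff[OF Nh] uc v by (simp add: quot_proj_def)
  qed
  from coset_UN[OF Nt v, of "\<lambda>u. quot_proj V N (head Q a) (vmap V a u)"] this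
  show ?thesis by (simp add: quot_rep_def quot_proj_def)
qed

lemma quot_rep_is_rep:
  assumes V: "is_rep K Q V" and Q: "fin_digraph Q" and N: "is_subrep K Q V N"
  shows "is_rep K Q (quot_rep Q V N)" "rep_hom K Q V (quot_rep Q V N) (quot_proj V N)"
    "\<And>x. x \<in> verts Q \<Longrightarrow> quot_proj V N x ` carrier (vspace V x) = carrier (vspace (quot_rep Q V N) x)"
proof -
  interpret Q: fin_digraph Q by fact
  let ?W = "quot_rep Q V N"
  have N': "subspace K (N x) (vspace V x)" if "x \<in> verts Q" for x
    using N that by (simp add: is_subrep_def)
  have lin: "linear_map K (vspace V x) (vspace ?W x) (quot_proj V N x)" if "x \<in> verts Q" for x
    using quot_linear(2)[OF N'[OF that]] by (simp add: quot_rep_def quot_proj_def [abs_def])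
  show surj: "quot_proj V N x ` carrier (vspace V x) = carrier (vspace ?W x)" if "x \<in> verts Q" for x
    using quot_linear(3)[OF N'[OF that]] by (simp add: quot_rep_def quot_proj_def [abs_def])
  show "rep_hom K Q V ?W (quot_proj V N)"
    using lin quot_map_coset[OF V Q N] by (auto simp: rep_hom_def)
  have "linear_map K (vspace ?W (tail Q a)) (vspace ?W (head Q a)) (vmap ?W a)"
    if a: "a \<in> arcs Q" for a
  proof -
    interpret f: linear_map K "vspace V (tail Q a)" "vspace V (head Q a)" "vmap V a"
      using V a by (simp add: is_rep_def)
    interpret t: linear_map K "vspace V (tail Q a)" "vspace ?W (tail Q a)" "quot_proj V N (tail Q a)"
      using lin a by simp
    interpret h: linear_map K "vspace V (head Q a)" "vspace ?W (head Q a)" "quot_proj V N (head Q a)"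
      using lin a by simp
    have c: "carrier (vspace ?W (tail Q a)) = quot_proj V N (tail Q a) ` carrier (vspace V (tail Q a))"
      using surj a by simp
    note q = quot_map_coset[OF V Q N a]
    show ?thesis
      by unfold_locales
        (auto simp: module_hom_def c q t.T_add[symmetric] t.T_smult[symmetric]
           simp del: t.T_add t.T_smult)
  qed
  moreover have "vectorspace.fin_dim K (vspace ?W x)" if x: "x \<in> verts Q" for x
  proof -
    interpret linear_map K "vspace V x" "vspace ?W x" "quot_proj V N x"
      using lin x by simp
    show ?thesis using V x rank_nullity_main(2) surj[OF x] by (simp add: is_rep_def)
  qed
  ultimately show "is_rep K Q ?W"
    using lin by (auto simp: is_rep_def linear_map_def)
qed

lemma monomorphic_quot_iff:
  assumes V: "is_rep K Q V" and Q: "fin_digraph Q" and N: "is_subrep K Q V N"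
  shows "monomorphic_rep Q (quot_rep Q V N) \<longleftrightarrow>
    (\<forall>a \<in> arcs Q. \<forall>v \<in> carrier (vspace V (tail Q a)). vmap V a v \<in> N (head Q a) \<longrightarrow> v \<in> N (tail Q a))"
proof -
  interpret Q: fin_digraph Q by fact
  let ?W = "quot_rep Q V N"
  have "inj_on (vmap ?W a) (carrier (vspace ?W (tail Q a))) \<longleftrightarrow>
    (\<forall>v \<in> carrier (vspace V (tail Q a)). vmap V a v \<in> N (head Q a) \<longrightarrow> v \<in> N (tail Q a))"
    if a: "a \<in> arcs Q" for a
  proof -
    interpret f: linear_map K "vspace V (tail Q a)" "vspace V (head Q a)" "vmap V a"
      using V a by (simp add: is_rep_def)
    have Nt: "subspace K (N (tail Q a)) (vspace V (tail Q a))"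
      and Nh: "subspace K (N (head Q a)) (vspace V (head Q a))"
      using N a by (auto simp: is_subrep_def)
    have quot_proj_eq_iff:
      "quot_proj V N (tail Q a) v = quot_proj V N (tail Q a) w
         \<longleftrightarrow> v \<ominus>\<^bsub>vspace V (tail Q a)\<^esub> w \<in> N (tail Q a)"
      "quot_proj V N (head Q a) (vmap V a v) = quot_proj V N (head Q a) (vmap V a w)
         \<longleftrightarrow> vmap V a (v \<ominus>\<^bsub>vspace V (tail Q a)\<^esub> w) \<in> N (head Q a)"
      if "v \<in> carrier (vspace V (tail Q a))" "w \<in> carrier (vspace V (tail Q a))" for v w
      using that coset_eq_iff[OF Nt] coset_eq_iff[OF Nh] by (simp_all add: quot_proj_def)
    have c: "carrier (vspace ?W (tail Q a)) = quot_proj V N (tail Q a) ` carrier (vspace V (tail Q a))"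
      using quot_rep_is_rep(3)[OF V Q N] a by simp
    have "inj_on (vmap ?W a) (carrier (vspace ?W (tail Q a))) \<longleftrightarrow>
      (\<forall>v \<in> carrier (vspace V (tail Q a)). \<forall>w \<in> carrier (vspace V (tail Q a)).
         vmap V a (v \<ominus>\<^bsub>vspace V (tail Q a)\<^esub> w) \<in> N (head Q a) \<longrightarrow>
         v \<ominus>\<^bsub>vspace V (tail Q a)\<^esub> w \<in> N (tail Q a))"
      by (simp add: c inj_on_def quot_map_coset[OF V Q N a] quot_proj_eq_iff)
    also have "\<dots> \<longleftrightarrow> (\<forall>v \<in> carrier (vspace V (tail Q a)).
        vmap V a v \<in> N (head Q a) \<longrightarrow> v \<in> N (tail Q a))" (is "?L \<longleftrightarrow> ?R")
    proof
      have vt: "vectorspace K (vspace V (tail Q a))" by (rule subspaceD(1)[OF Nt])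
      have z: "\<zero>\<^bsub>vspace V (tail Q a)\<^esub> \<in> carrier (vspace V (tail Q a))"
        using subspaceD(2,3)[OF Nt] by blast
      assume L: ?L
      show ?R
      proof
        fix v assume v: "v \<in> carrier (vspace V (tail Q a))"
        have "v \<ominus>\<^bsub>vspace V (tail Q a)\<^esub> \<zero>\<^bsub>vspace V (tail Q a)\<^esub> = v"
          by (rule vs_minus(1)[OF vt v])
        then show "vmap V a v \<in> N (head Q a) \<longrightarrow> v \<in> N (tail Q a)"
          using L z v by metis
      qed
    qed (use vs_minus(2)[OF subspaceD(1)[OF Nt]] in blast)
    finally show ?thesis .
  qed
  then show ?thesis by (simp add: monomorphic_rep_def)
qed

lemma mono_quot_universal:
  assumes V: "is_rep K Q V" and Q: "fin_digraph Q"
  shows "is_subrep K Q V (mono_kernel K Q V)"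
    and "monomorphic_rep Q (mono_quot K Q V)"
    and "\<And>W \<pi>. \<lbrakk>is_rep K Q W; monomorphic_rep Q W; rep_hom K Q V W \<pi>;
         \<And>x. x \<in> verts Q \<Longrightarrow> \<pi> x ` carrier (vspace V x) = carrier (vspace W x)\<rbrakk>
      \<Longrightarrow> \<exists>\<psi>. rep_hom K Q (mono_quot K Q V) W \<psi> \<and>
            (\<forall>x \<in> verts Q. \<forall>v \<in> carrier (vspace V x).
                \<psi> x (quot_proj V (mono_kernel K Q V) x v) = \<pi> x v)"
proof -
  interpret Q: fin_digraph Q by fact
  let ?P = "\<lambda>N. is_subrep K Q V N \<and> monomorphic_rep Q (quot_rep Q V N)"
  let ?N = "mono_kernel K Q V"
  have N: "?N x = \<Inter>{N x | N. ?P N}" for x by (simp add: mono_kernel_def)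
  have vs: "vectorspace K (vspace V x)" if "x \<in> verts Q" for x
    using V that by (simp add: is_rep_def)
  have lin: "linear_map K (vspace V (tail Q a)) (vspace V (head Q a)) (vmap V a)"
    if "a \<in> arcs Q" for a
    using V that by (simp add: is_rep_def)
  have clos: "vmap V a v \<in> carrier (vspace V (head Q a))"
    if "a \<in> arcs Q" "v \<in> carrier (vspace V (tail Q a))" for a v
    using mod_hom.f_im[OF linear_map.axioms(3)[OF lin]] that by blast
  have top: "is_subrep K Q V (\<lambda>x. carrier (vspace V x))"
  proof -
    have "subspace K (carrier (vspace V x)) (vspace V x)" if "x \<in> verts Q" for x
    proof -
      interpret vectorspace K "vspace V x" using vs that .
      show ?thesis by (rule subspaceI) (auto intro: vs that)
    qed
    then show ?thesis using clos by (auto simp: is_subrep_def)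
  qed
  have topP: "?P (\<lambda>x. carrier (vspace V x))"
    using monomorphic_quot_iff[OF V Q top] top by simp
  show sub: "is_subrep K Q V ?N"
    unfolding is_subrep_def
  proof (intro conjI ballI)
    fix x assume x: "x \<in> verts Q"
    have *: "subspace K (N x) (vspace V x)" if "?P N" for N using that x by (simp add: is_subrep_def)
    show "subspace K (?N x) (vspace V x)"
    proof (rule subspaceI)
      show "?N x \<subseteq> carrier (vspace V x)" unfolding N using topP by blast
    next
      show "\<zero>\<^bsub>vspace V x\<^esub> \<in> ?N x" unfolding N using subspaceD(3)[OF *] by blast
      fix v w assume "v \<in> ?N x" "w \<in> ?N x"
      then show "v \<oplus>\<^bsub>vspace V x\<^esub> w \<in> ?N x" unfolding N using subspaceD(4)[OF *] by blast
    next
      fix k v assume "k \<in> carrier K" "v \<in> ?N x"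
      then show "k \<odot>\<^bsub>vspace V x\<^esub> v \<in> ?N x" unfolding N using subspaceD(5)[OF *] by blast
    qed (rule vs[OF x])
  next
    fix a assume a: "a \<in> arcs Q"
    have "vmap V a ` N (tail Q a) \<subseteq> N (head Q a)" if "?P N" for N
      using that a by (simp add: is_subrep_def)
    then show "vmap V a ` ?N (tail Q a) \<subseteq> ?N (head Q a)" unfolding N by blast
  qed
  show "monomorphic_rep Q (mono_quot K Q V)"
    unfolding mono_quot_def monomorphic_quot_iff[OF V Q sub]
  proof (intro ballI impI)
    fix a v assume a: "a \<in> arcs Q" and v: "v \<in> carrier (vspace V (tail Q a))"
      and h: "vmap V a v \<in> ?N (head Q a)"
    have "v \<in> N (tail Q a)" if P: "?P N" for N
    proof -
      have "vmap V a v \<in> N (head Q a)" using h P unfolding N by blast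
      then show ?thesis using monomorphic_quot_iff[OF V Q, of N] P a v by blast
    qed
    then show "v \<in> ?N (tail Q a)" unfolding N by blast
  qed
  fix W \<pi>
  assume W: "is_rep K Q W" "monomorphic_rep Q W" and hom: "rep_hom K Q V W \<pi>"
  have lp: "linear_map K (vspace V x) (vspace W x) (\<pi> x)" if "x \<in> verts Q" for x
    using hom that by (simp add: rep_hom_def)
  have nat: "\<pi> (head Q a) (vmap V a v) = vmap W a (\<pi> (tail Q a) v)"
    if "a \<in> arcs Q" "v \<in> carrier (vspace V (tail Q a))" for a v
    using hom that by (simp add: rep_hom_def)
  define L where "L x = {v \<in> carrier (vspace V x). \<pi> x v = \<zero>\<^bsub>vspace W x\<^esub>}" for x
  have W0: "vmap W a \<zero>\<^bsub>vspace W (tail Q a)\<^esub> = \<zero>\<^bsub>vspace W (head Q a)\<^esub>" if a: "a \<in> arcs Q" for a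
  proof -
    interpret linear_map K "vspace W (tail Q a)" "vspace W (head Q a)" "vmap W a"
      using W a by (simp add: is_rep_def)
    show ?thesis by simp
  qed
  have Lsub: "is_subrep K Q V L"
    unfolding is_subrep_def
  proof (intro conjI ballI)
    fix x assume x: "x \<in> verts Q"
    interpret linear_map K "vspace V x" "vspace W x" "\<pi> x" using lp[OF x] .
    show "subspace K (L x) (vspace V x)" using kerT_is_subspace by (simp add: L_def ker_def)
  next
    fix a assume a: "a \<in> arcs Q"
    show "vmap V a ` L (tail Q a) \<subseteq> L (head Q a)"
      using clos[OF a] nat[OF a] W0[OF a] by (auto simp: L_def)
  qed
  have "?P L"
    unfolding monomorphic_quot_iff[OF V Q Lsub]
  proof (intro conjI Lsub ballI impI)
    fix a v assume a: "a \<in> arcs Q" and v: "v \<in> carrier (vspace V (tail Q a))"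
      and h: "vmap V a v \<in> L (head Q a)"
    interpret linear_map K "vspace V (tail Q a)" "vspace W (tail Q a)" "\<pi> (tail Q a)"
      using lp a by simp
    have "vmap W a (\<pi> (tail Q a) v) = vmap W a \<zero>\<^bsub>vspace W (tail Q a)\<^esub>"
      using h nat[OF a v] W0[OF a] by (simp add: L_def)
    then have "\<pi> (tail Q a) v = \<zero>\<^bsub>vspace W (tail Q a)\<^esub>"
      using W(2) a v by (auto simp: monomorphic_rep_def inj_on_def)
    then show "v \<in> L (tail Q a)" using v by (simp add: L_def)
  qed
  then have NL: "?N x \<subseteq> L x" for x unfolding N by blast
  define \<psi> where "\<psi> x A = \<pi> x (SOME v. v \<in> carrier (vspace V x) \<and> quot_proj V ?N x v = A)" for x A
  have \<psi>: "\<psi> x (quot_proj V ?N x v) = \<pi> x v"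
    if x: "x \<in> verts Q" and v: "v \<in> carrier (vspace V x)" for x v
  proof -
    interpret linear_map K "vspace V x" "vspace W x" "\<pi> x" using lp[OF x] .
    define w where "w = (SOME w. w \<in> carrier (vspace V x) \<and> quot_proj V ?N x w = quot_proj V ?N x v)"
    have w: "w \<in> carrier (vspace V x)" "quot_proj V ?N x w = quot_proj V ?N x v"
      using someI[of "\<lambda>w. w \<in> carrier (vspace V x) \<and> quot_proj V ?N x w = quot_proj V ?N x v" v] v
      by (auto simp: w_def)
    have "w \<ominus>\<^bsub>vspace V x\<^esub> v \<in> ?N x"
      using coset_eq_iff[of K "?N x" "vspace V x" w v] sub x v w by (auto simp: is_subrep_def quot_proj_def)
    then have "\<pi> x w \<ominus>\<^bsub>vspace W x\<^esub> \<pi> x v = \<zero>\<^bsub>vspace W x\<^esub>"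
      using NL[of x] T_minus[OF w(1) v] by (auto simp: L_def)
    moreover have vW: "vectorspace K (vspace W x)" using W(1) x by (simp add: is_rep_def)
    ultimately have "\<pi> x w = \<pi> x v" by (intro vs_minus(3)[OF vW T_im[OF w(1)] T_im[OF v]])
    then show ?thesis unfolding \<psi>_def w_def .
  qed
  let ?M = "mono_quot K Q V"
  note q = quot_rep_is_rep[OF V Q sub, folded mono_quot_def]
  have "rep_hom K Q ?M W \<psi>"
    unfolding rep_hom_def
  proof (intro conjI ballI)
    fix x assume x: "x \<in> verts Q"
    interpret p: linear_map K "vspace V x" "vspace W x" "\<pi> x" using lp[OF x] .
    interpret q: linear_map K "vspace V x" "vspace ?M x" "quot_proj V ?N x"
      using q(2) x by (simp add: rep_hom_def)
    show "linear_map K (vspace ?M x) (vspace W x) (\<psi> x)"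
      by unfold_locales
        (auto simp: module_hom_def q(3)[OF x, symmetric] \<psi>[OF x] q.T_add[symmetric]
           q.T_smult[symmetric] simp del: q.T_add q.T_smult)
  next
    fix a A assume a: "a \<in> arcs Q" and "A \<in> carrier (vspace ?M (tail Q a))"
    then obtain v where v: "v \<in> carrier (vspace V (tail Q a))" "A = quot_proj V ?N (tail Q a) v"
      using q(3)[of "tail Q a"] by auto
    then show "\<psi> (head Q a) (vmap ?M a A) = vmap W a (\<psi> (tail Q a) A)"
      using a quot_map_coset[OF V Q sub a v(1)] clos[OF a v(1)]
      by (simp add: mono_quot_def \<psi> nat)
  qed
  then show "\<exists>\<psi>. rep_hom K Q ?M W \<psi> \<and>
      (\<forall>x \<in> verts Q. \<forall>v \<in> carrier (vspace V x). \<psi> x (quot_proj V ?N x v) = \<pi> x v)"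
    using \<psi> by blast
qed

lemma global_tensor_subrep:
  assumes V: "is_rep K Q V" and Q: "fin_digraph Q"
  shows "is_subrep K Q (mono_quot K Q V) (\<lambda>x. quot_proj V (mono_kernel K Q V) x ` epi_part K Q V x)"
proof -
  interpret Q: fin_digraph Q by fact
  note q = quot_rep_is_rep[OF V Q mono_quot_universal(1)[OF V Q], folded mono_quot_def]
  note e = epi_part_greatest(1)[OF V Q]
  show ?thesis unfolding is_subrep_def
  proof (intro conjI ballI)
    fix x assume x: "x \<in> verts Q"
    have s: "subspace K (epi_part K Q V x) (vspace V x)" using e x by (simp add: is_subrep_def)
    show "subspace K (quot_proj V (mono_kernel K Q V) x ` epi_part K Q V x) (vspace (mono_quot K Q V) x)"
      by (rule image_subspace[OF _ s]) (use q(2) x in \<open>simp add: rep_hom_def\<close>)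
  next
    fix a assume a: "a \<in> arcs Q"
    have "subspace K (epi_part K Q V (tail Q a)) (vspace V (tail Q a))" using e a by (simp add: is_subrep_def)
    note c = subspaceD(2)[OF this]
    have "vmap V a ` epi_part K Q V (tail Q a) \<subseteq> epi_part K Q V (head Q a)"
      using e a by (simp add: is_subrep_def)
    moreover have "vmap (mono_quot K Q V) a (quot_proj V (mono_kernel K Q V) (tail Q a) v)
        = quot_proj V (mono_kernel K Q V) (head Q a) (vmap V a v)"
      if "v \<in> carrier (vspace V (tail Q a))" for v
      using q(2) a that by (simp add: rep_hom_def)
    ultimately show "vmap (mono_quot K Q V) a ` quot_proj V (mono_kernel K Q V) (tail Q a) ` epi_part K Q V (tail Q a)
       \<subseteq> quot_proj V (mono_kernel K Q V) (head Q a) ` epi_part K Q V (head Q a)"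
      using c by (auto simp: subset_iff)
  qed
qed

end

theory Submission
  imports Defs
begin

text \<open>
  Write \<open>E\<close> for the maximal epimorphic subrepresentation of \<open>V\<close> and \<open>N\<close> for the kernel of the
  maximal monomorphic quotient \<open>M = V / N\<close>; the global tensor functor vanishes on \<open>V\<close> iff
  \<open>E \<subseteq> N\<close> (\<open>zero_global_tensor_iff\<close>).

  Suppose \<open>v \<in> E\<close>, at a vertex \<open>r\<close>, does not lie in \<open>N\<close>.  All arrows act surjectively on \<open>E\<close>,
  so the value \<open>v\<close> at \<open>r\<close> can be pushed forward and lifted back along the arrows of the tree
  to a compatible family of vectors, that is, to a homomorphism from the identity representation
  to \<open>V\<close> (\<open>hom_from_identity_rep\<close>).  Dually, all arrows act injectively on \<open>M\<close>, so a functional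
  on \<open>M\<close> at \<open>r\<close> with value 1 on the class of \<open>v\<close> spreads to a homomorphism from \<open>V\<close> to the
  identity representation (\<open>hom_to_identity_rep\<close>).  Both follow from one statement about
  trees, \<open>tree_compatible_family\<close>.  The composition of the two homomorphisms is the
  scalar 1 at \<open>r\<close>, hence everywhere, so the identity representation is a direct summand
  of \<open>V\<close>, and \<open>V\<close> is isomorphic to it if it is indecomposable.  Conversely, a representation
  isomorphic to the identity representation is epimorphic and monomorphic, so there
  \<open>E\<close> is everything and \<open>N\<close> is zero.

  The statement on direct sums follows since \<open>E\<close> and \<open>N\<close> are functorial, hence compatible with
  finite direct sums: see \<open>global_tensor_dsum\<close>.
\<close>


section \<open>Choices along a tree\<close>

text \<open>
  The symmetric adjacency relation of a set of arrows.  It describes connectivity of a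
  quiver, of a quiver with an arrow deleted and of a full subquiver alike.
\<close>

definition adj_rel :: "('q, 'e) pre_digraph \<Rightarrow> 'e set \<Rightarrow> ('q \<times> 'q) set" where
  "adj_rel Q A = (\<Union>a \<in> A. {(tail Q a, head Q a), (head Q a, tail Q a)})"

lemma adj_rel_mono: "A \<subseteq> B \<Longrightarrow> (x, y) \<in> (adj_rel Q A)\<^sup>* \<Longrightarrow> (x, y) \<in> (adj_rel Q B)\<^sup>*"
  using rtrancl_mono[of "adj_rel Q A" "adj_rel Q B"] by (auto simp: adj_rel_def)

lemma adj_rel_sym: "(x, y) \<in> (adj_rel Q A)\<^sup>* \<Longrightarrow> (y, x) \<in> (adj_rel Q A)\<^sup>*"
  by (rule symD[OF sym_rtrancl]) (auto simp: adj_rel_def sym_def)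

lemma connected_iff_adj_rel:
  assumes "wf_digraph Q"
  shows "connected Q \<longleftrightarrow>
    verts Q \<noteq> {} \<and> (\<forall>x \<in> verts Q. \<forall>y \<in> verts Q. (x, y) \<in> (adj_rel Q (arcs Q))\<^sup>*)"
proof -
  interpret wf_digraph Q by fact
  interpret S: pair_wf_digraph "mk_symmetric Q" ..
  have e: "parcs (mk_symmetric Q) = adj_rel Q (arcs Q)"
    by (simp add: parcs_mk_symmetric adj_rel_def)
  have "(x, y) \<in> (adj_rel Q (arcs Q))\<^sup>* \<longleftrightarrow> x \<rightarrow>\<^sup>*\<^bsub>mk_symmetric Q\<^esub> y"
    if "x \<in> verts Q" for x y
  proof
    assume "(x, y) \<in> (adj_rel Q (arcs Q))\<^sup>*"
    then show "x \<rightarrow>\<^sup>*\<^bsub>mk_symmetric Q\<^esub> y"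
    proof induction
      case base
      then show ?case using that by simp
    next
      case (step y z)
      then have "(y, z) \<in> parcs (mk_symmetric Q)" by (simp add: e)
      with step.IH show ?case by (rule S.reachable_adj_trans)
    qed
  next
    assume "x \<rightarrow>\<^sup>*\<^bsub>mk_symmetric Q\<^esub> y"
    then show "(x, y) \<in> (adj_rel Q (arcs Q))\<^sup>*"
      using reachable_rtranclI[of "with_proj (mk_symmetric Q)" x y] by (simp add: e)
  qed
  then show ?thesis
    unfolding connected_def strongly_connected_def by (metis pverts_mk_symmetric with_proj_simps(1))
qed

lemma tree_arc_is_bridge:
  assumes Q: "wf_digraph Q" and T: "tree_quiver Q" and a: "a \<in> arcs Q"
  shows "(tail Q a, head Q a) \<notin> (adj_rel Q (arcs Q - {a}))\<^sup>*"
proof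
  assume r: "(tail Q a, head Q a) \<in> (adj_rel Q (arcs Q - {a}))\<^sup>*"
  interpret wf_digraph Q by fact
  have eq: "adj_rel (del_arc a) A = adj_rel Q A" for A by (simp add: adj_rel_def)
  have "adj_rel Q (arcs Q) \<subseteq> (adj_rel Q (arcs Q - {a}))\<^sup>*"
    using r adj_rel_sym[OF r] by (auto simp: adj_rel_def)
  then have "(adj_rel Q (arcs Q))\<^sup>* \<subseteq> (adj_rel Q (arcs Q - {a}))\<^sup>*"
    by (metis rtrancl_idemp rtrancl_mono)
  then have "connected (del_arc a)"
    using T connected_iff_adj_rel[OF Q] connected_iff_adj_rel[of "del_arc a"] wf_digraph_del_arc
    unfolding tree_quiver_def by (auto simp: eq)
  then show False using T a by (simp add: tree_quiver_def)
qed

text \<open>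
  A family over the vertices of a tree that is compatible along all arrows exists as soon as each
  arrow allows passing from an admissible value at either end to one at the other; its value at
  one vertex can be prescribed.  The vertices are exhausted by growing a connected full
  subquiver: since every arrow is a bridge, a new vertex is joined to it by a single arrow.
\<close>

lemma tree_compatible_family:
  assumes Q: "fin_digraph Q" and T: "tree_quiver Q"
    and fwd: "\<And>a u. a \<in> arcs Q \<Longrightarrow> u \<in> A (tail Q a) \<Longrightarrow> \<exists>w \<in> A (head Q a). R a u w"
    and bwd: "\<And>a w. a \<in> arcs Q \<Longrightarrow> w \<in> A (head Q a) \<Longrightarrow> \<exists>u \<in> A (tail Q a). R a u w"
    and r: "r \<in> verts Q" "u \<in> A r"
  obtains s where "s r = u" "\<And>x. x \<in> verts Q \<Longrightarrow> s x \<in> A x"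
    "\<And>a. a \<in> arcs Q \<Longrightarrow> R a (s (tail Q a)) (s (head Q a))"
proof -
  interpret fin_digraph Q by fact
  have wf: "wf_digraph Q" ..
  note bridge = tree_arc_is_bridge[OF wf T]
  have noloop: "tail Q b \<noteq> head Q b" if "b \<in> arcs Q" for b
    using bridge[OF that] by auto
  \<comment> \<open>\<open>I X\<close> is the set of arrows inside \<open>X\<close>; \<open>G X s\<close> says that \<open>X\<close> is connected, contains the root \<open>r\<close>,
    and that \<open>s\<close> is a compatible family on it.\<close>
  define I where "I X = {a \<in> arcs Q. tail Q a \<in> X \<and> head Q a \<in> X}" for X
  define G where "G X s \<longleftrightarrow> r \<in> X \<and> X \<subseteq> verts Q \<and> (\<forall>x \<in> X. (r, x) \<in> (adj_rel Q (I X))\<^sup>*) \<and>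
      s r = u \<and> (\<forall>x \<in> X. s x \<in> A x) \<and> (\<forall>a \<in> I X. R a (s (tail Q a)) (s (head Q a)))" for X s
  have "\<exists>X s. card X = Suc n \<and> G X s" if "Suc n \<le> card (verts Q)" for n
    using that
  proof (induction n)
    case 0
    have "I {r} = {}" using noloop by (fastforce simp: I_def)
    then have "G {r} (\<lambda>_. u)" using r by (auto simp: G_def)
    then show ?case by (intro exI[of _ "{r}"]) auto
  next
    case (Suc n)
    then obtain X s where X: "card X = Suc n" and G: "G X s" by auto
    have rX: "r \<in> X" and XQ: "X \<subseteq> verts Q" and
      cX: "\<And>x. x \<in> X \<Longrightarrow> (r, x) \<in> (adj_rel Q (I X))\<^sup>*" and sr: "s r = u" and
      sA: "\<And>x. x \<in> X \<Longrightarrow> s x \<in> A x" and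
      sR: "\<And>a. a \<in> I X \<Longrightarrow> R a (s (tail Q a)) (s (head Q a))"
      using G unfolding G_def by auto
    have finX: "finite X" using XQ finite_verts by (rule finite_subset)
    have "X \<noteq> verts Q" using X Suc.prems by auto
    then obtain z where z: "z \<in> verts Q" "z \<notin> X" using XQ by blast
    have "(r, z) \<in> (adj_rel Q (arcs Q))\<^sup>*"
      using T r z connected_iff_adj_rel[OF wf] by (simp add: tree_quiver_def)
    from this z(2) have "\<exists>x y. x \<in> X \<and> y \<notin> X \<and> (x, y) \<in> adj_rel Q (arcs Q)"
      using rX by induction auto
    then obtain x y a where xy: "x \<in> X" "y \<notin> X" and a: "a \<in> arcs Q"
      and e: "x = tail Q a \<and> y = head Q a \<or> x = head Q a \<and> y = tail Q a"
      by (auto simp: adj_rel_def)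
    have yQ: "y \<in> verts Q" using e a by auto
    have aX: "a \<notin> I X" using xy e by (auto simp: I_def)
    \<comment> \<open>A second arrow between \<open>X\<close> and \<open>y\<close> would be a detour around the bridge \<open>a\<close>.\<close>
    have uniq: "b = a" if b: "b \<in> arcs Q" and
      e': "x' = tail Q b \<and> y = head Q b \<or> x' = head Q b \<and> y = tail Q b" and x': "x' \<in> X" for b x'
    proof (rule ccontr)
      assume ne: "b \<noteq> a"
      have sub: "I X \<subseteq> arcs Q - {a}" using aX by (auto simp: I_def)
      have "(x, r) \<in> (adj_rel Q (arcs Q - {a}))\<^sup>*" "(r, x') \<in> (adj_rel Q (arcs Q - {a}))\<^sup>*"
        using adj_rel_mono[OF sub adj_rel_sym[OF cX[OF xy(1)]]] adj_rel_mono[OF sub cX[OF x']]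
        by auto
      moreover have "(x', y) \<in> adj_rel Q (arcs Q - {a})"
        using e' b ne by (auto simp: adj_rel_def)
      ultimately have "(x, y) \<in> (adj_rel Q (arcs Q - {a}))\<^sup>*" by auto
      then show False using bridge[OF a] e adj_rel_sym[of x y] by auto
    qed
    have IX: "I (insert y X) = insert a (I X)"
    proof
      show "I (insert y X) \<subseteq> insert a (I X)"
      proof
        fix b assume b: "b \<in> I (insert y X)"
        then have bQ: "b \<in> arcs Q" by (simp add: I_def)
        show "b \<in> insert a (I X)"
          using b noloop[OF bQ] uniq[OF bQ, of "tail Q b"] uniq[OF bQ, of "head Q b"]
          by (auto simp: I_def)
      qed
      show "insert a (I X) \<subseteq> I (insert y X)" using a e xy by (auto simp: I_def)
    qed
    have "\<exists>w \<in> A y. (x = tail Q a \<longrightarrow> R a (s x) w) \<and> (x = head Q a \<longrightarrow> R a w (s x))"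
      using e
    proof
      assume "x = tail Q a \<and> y = head Q a"
      then show ?thesis using fwd[OF a, of "s x"] sA[OF xy(1)] noloop[OF a] by auto
    next
      assume "x = head Q a \<and> y = tail Q a"
      then show ?thesis using bwd[OF a, of "s x"] sA[OF xy(1)] noloop[OF a] by auto
    qed
    then obtain w where w: "w \<in> A y" "x = tail Q a \<Longrightarrow> R a (s x) w" "x = head Q a \<Longrightarrow> R a w (s x)"
      by auto
    have "(r, v) \<in> (adj_rel Q (I (insert y X)))\<^sup>*" if "v \<in> insert y X" for v
    proof -
      have *: "(r, v) \<in> (adj_rel Q (I (insert y X)))\<^sup>*" if "v \<in> X" for v
        by (rule adj_rel_mono[OF _ cX[OF that]]) (auto simp: IX)
      moreover have "(x, y) \<in> adj_rel Q (I (insert y X))"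
        using e by (auto simp: IX adj_rel_def)
      ultimately show ?thesis using that xy(1) by (metis insertE rtrancl.rtrancl_into_rtrancl)
    qed
    moreover have "R b ((s(y := w)) (tail Q b)) ((s(y := w)) (head Q b))" if "b \<in> I (insert y X)" for b
    proof (cases "b = a")
      case True
      then show ?thesis using e w xy by auto
    next
      case False
      then have "b \<in> I X" using that IX by auto
      moreover then have "tail Q b \<noteq> y" "head Q b \<noteq> y" using xy by (auto simp: I_def)
      ultimately show ?thesis using sR by auto
    qed
    ultimately have "G (insert y X) (s(y := w))"
      using rX XQ sr sA w(1) xy yQ unfolding G_def by auto
    moreover have "card (insert y X) = Suc (Suc n)" using X xy finX by simp
    ultimately show ?case by blast
  qed
  moreover have "card (verts Q) \<noteq> 0" using r by auto
  ultimately obtain X s where X: "card X = card (verts Q)" and G: "G X s"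
    by (metis not0_implies_Suc order_refl)
  have "X = verts Q" using X G finite_verts by (auto simp: G_def card_subset_eq)
  then show ?thesis using G that[of s] unfolding G_def I_def by auto
qed


section \<open>Linear maps and functionals\<close>

lemma linear_mapI:
  assumes "vectorspace K V" "vectorspace K W"
    and "\<And>v. v \<in> carrier V \<Longrightarrow> f v \<in> carrier W"
    and "\<And>v w. v \<in> carrier V \<Longrightarrow> w \<in> carrier V \<Longrightarrow> f (v \<oplus>\<^bsub>V\<^esub> w) = f v \<oplus>\<^bsub>W\<^esub> f w"
    and "\<And>k v. k \<in> carrier K \<Longrightarrow> v \<in> carrier V \<Longrightarrow> f (k \<odot>\<^bsub>V\<^esub> v) = k \<odot>\<^bsub>W\<^esub> f v"
  shows "linear_map K V W f"
proof -
  interpret V: vectorspace K V by fact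
  interpret W: vectorspace K W by fact
  show ?thesis by unfold_locales (use assms(3-) in \<open>auto simp: module_hom_def\<close>)
qed

lemma linear_mapD:
  assumes "linear_map K V W f"
  shows "vectorspace K V" "vectorspace K W"
    and "\<And>v. v \<in> carrier V \<Longrightarrow> f v \<in> carrier W"
    and "\<And>v w. v \<in> carrier V \<Longrightarrow> w \<in> carrier V \<Longrightarrow> f (v \<oplus>\<^bsub>V\<^esub> w) = f v \<oplus>\<^bsub>W\<^esub> f w"
    and "\<And>k v. k \<in> carrier K \<Longrightarrow> v \<in> carrier V \<Longrightarrow> f (k \<odot>\<^bsub>V\<^esub> v) = k \<odot>\<^bsub>W\<^esub> f v"
    and "f \<zero>\<^bsub>V\<^esub> = \<zero>\<^bsub>W\<^esub>"
    and "\<And>v w. v \<in> carrier V \<Longrightarrow> w \<in> carrier V \<Longrightarrow> f (v \<ominus>\<^bsub>V\<^esub> w) = f v \<ominus>\<^bsub>W\<^esub> f w"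
proof -
  interpret linear_map K V W f by fact
  show "vectorspace K V" "vectorspace K W" ..
  show "\<And>v. v \<in> carrier V \<Longrightarrow> f v \<in> carrier W"
    "\<And>v w. v \<in> carrier V \<Longrightarrow> w \<in> carrier V \<Longrightarrow> f (v \<oplus>\<^bsub>V\<^esub> w) = f v \<oplus>\<^bsub>W\<^esub> f w"
    "\<And>k v. k \<in> carrier K \<Longrightarrow> v \<in> carrier V \<Longrightarrow> f (k \<odot>\<^bsub>V\<^esub> v) = k \<odot>\<^bsub>W\<^esub> f v"
    "f \<zero>\<^bsub>V\<^esub> = \<zero>\<^bsub>W\<^esub>"
    "\<And>v w. v \<in> carrier V \<Longrightarrow> w \<in> carrier V \<Longrightarrow> f (v \<ominus>\<^bsub>V\<^esub> w) = f v \<ominus>\<^bsub>W\<^esub> f w"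
    by auto
qed

lemma linear_map_comp:
  assumes f: "linear_map K U V f" and g: "linear_map K V W g"
  shows "linear_map K U W (\<lambda>u. g (f u))"
  using linear_mapD[OF f] linear_mapD[OF g] by (intro linear_mapI) auto

lemma linear_map_inj_onI:
  assumes f: "linear_map K V W f"
    and z: "\<And>v. v \<in> carrier V \<Longrightarrow> f v = \<zero>\<^bsub>W\<^esub> \<Longrightarrow> v = \<zero>\<^bsub>V\<^esub>"
  shows "inj_on f (carrier V)"
proof (rule inj_onI)
  fix v w assume *: "v \<in> carrier V" "w \<in> carrier V" "f v = f w"
  interpret V: vectorspace K V using linear_mapD(1)[OF f] .
  interpret W: vectorspace K W using linear_mapD(2)[OF f] .
  have "f (v \<ominus>\<^bsub>V\<^esub> w) = f w \<ominus>\<^bsub>W\<^esub> f w" using * linear_mapD(7)[OF f, of v w] by metis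
  also have "\<dots> = \<zero>\<^bsub>W\<^esub>"
    using linear_mapD(3)[OF f *(2)] by (simp add: W.M.minus_eq W.M.r_neg)
  finally have "f (v \<ominus>\<^bsub>V\<^esub> w) = \<zero>\<^bsub>W\<^esub>" .
  then have "v \<ominus>\<^bsub>V\<^esub> w = \<zero>\<^bsub>V\<^esub>" by (rule z[OF V.M.minus_closed[OF *(1,2)]])
  then show "v = w" by (rule vs_minus(3)[OF linear_mapD(1)[OF f] *(1,2)])
qed

lemma linear_map_inv_into:
  assumes f: "linear_map K V W f" and b: "bij_betw f (carrier V) (carrier W)"
  shows "linear_map K W V (inv_into (carrier V) f)"
proof -
  let ?g = "inv_into (carrier V) f"
  note D = linear_mapD[OF f]
  interpret V: vectorspace K V using D(1) .
  have g: "?g w \<in> carrier V" "f (?g w) = w" if "w \<in> carrier W" for w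
    using that b by (auto simp: bij_betw_def inv_into_into f_inv_into_f)
  have gf: "?g (f v) = v" if "v \<in> carrier V" for v
    using that b by (simp add: bij_betw_def)
  show ?thesis
  proof (rule linear_mapI[OF D(2,1) g(1)])
    fix v w assume vw: "v \<in> carrier W" "w \<in> carrier W"
    have "?g (v \<oplus>\<^bsub>W\<^esub> w) = ?g (f (?g v \<oplus>\<^bsub>V\<^esub> ?g w))" using vw g D(4) by simp
    then show "?g (v \<oplus>\<^bsub>W\<^esub> w) = ?g v \<oplus>\<^bsub>V\<^esub> ?g w" using gf vw g by simp
  next
    fix k w assume kw: "k \<in> carrier K" "w \<in> carrier W"
    have "?g (k \<odot>\<^bsub>W\<^esub> w) = ?g (f (k \<odot>\<^bsub>V\<^esub> ?g w))" using kw g D(5) by simp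
    then show "?g (k \<odot>\<^bsub>W\<^esub> w) = k \<odot>\<^bsub>V\<^esub> ?g w" using gf kw g by simp
  qed
qed

lemma restrict_linear_map:
  assumes f: "linear_map K V W f" and S: "subspace K S V"
  shows "linear_map K (V\<lparr>carrier := S\<rparr>) W f"
proof (rule linear_mapI)
  have c: "v \<in> carrier V" if "v \<in> carrier (V\<lparr>carrier := S\<rparr>)" for v
    using that subspaceD(2)[OF S] by auto
  note D = linear_mapD[OF f]
  show "f v \<in> carrier W" if "v \<in> carrier (V\<lparr>carrier := S\<rparr>)" for v using D(3) c that .
  show "f (v \<oplus>\<^bsub>V\<lparr>carrier := S\<rparr>\<^esub> w) = f v \<oplus>\<^bsub>W\<^esub> f w"
    if "v \<in> carrier (V\<lparr>carrier := S\<rparr>)" "w \<in> carrier (V\<lparr>carrier := S\<rparr>)" for v w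
    using D(4)[OF c c, OF that] by simp
  show "f (k \<odot>\<^bsub>V\<lparr>carrier := S\<rparr>\<^esub> v) = k \<odot>\<^bsub>W\<^esub> f v"
    if "k \<in> carrier K" "v \<in> carrier (V\<lparr>carrier := S\<rparr>)" for k v
    using D(5)[OF that(1) c[OF that(2)]] by simp
qed (use vectorspace.subspace_is_vs[OF subspaceD(1)[OF S] S] linear_mapD(2)[OF f] in auto)

text \<open>The field as a vector space over itself.\<close>

definition scalar_space :: "('k, 'm) ring_scheme \<Rightarrow> ('k, 'k) module" where
  "scalar_space K = \<lparr>carrier = carrier K, monoid.mult = monoid.mult K, one = one K,
     zero = zero K, add = add K, smult = monoid.mult K\<rparr>"

lemma scalar_space_simps [simp]:
  "carrier (scalar_space K) = carrier K" "\<zero>\<^bsub>scalar_space K\<^esub> = \<zero>\<^bsub>K\<^esub>"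
  "add (scalar_space K) = add K" "smult (scalar_space K) = monoid.mult K"
  by (simp_all add: scalar_space_def)

lemma scalar_space_vectorspace:
  assumes "field K" shows "vectorspace K (scalar_space K)"
proof -
  interpret field K by fact
  show ?thesis
    by (rule vs_criteria[OF assms])
      (auto simp: a_ac m_ac l_distr r_distr intro: add.r_inv_ex)
qed

text \<open>Linearity of a scalar-valued function on a subspace \<open>U\<close> of \<open>W\<close>.\<close>

definition functional_on ::
  "('k, 'm) ring_scheme \<Rightarrow> ('k, 'v) module \<Rightarrow> 'v set \<Rightarrow> ('v \<Rightarrow> 'k) \<Rightarrow> bool" where
  "functional_on K W U \<xi> \<longleftrightarrow>
     (\<forall>u \<in> U. \<xi> u \<in> carrier K) \<and>
     (\<forall>u \<in> U. \<forall>v \<in> U. \<xi> (u \<oplus>\<^bsub>W\<^esub> v) = \<xi> u \<oplus>\<^bsub>K\<^esub> \<xi> v) \<and>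
     (\<forall>k \<in> carrier K. \<forall>u \<in> U. \<xi> (k \<odot>\<^bsub>W\<^esub> u) = k \<otimes>\<^bsub>K\<^esub> \<xi> u)"

text \<open>If \<open>w\<close> is not in \<open>U\<close>, the extension to \<open>U + K w\<close> is the one that vanishes on \<open>w\<close>.\<close>

lemma functional_on_extend_by_vector:
  assumes U: "subspace K U W" and f: "functional_on K W U \<xi>" and w: "w \<in> carrier W"
  obtains U' \<eta> where "subspace K U' W" "U \<subseteq> U'" "w \<in> U'" "functional_on K W U' \<eta>"
    "\<And>u. u \<in> U \<Longrightarrow> \<eta> u = \<xi> u"
proof (cases "w \<in> U")
  case True
  then show ?thesis using that[of U \<xi>] U f by auto
next
  case False
  note S = subspaceD[OF U]
  interpret W: vectorspace K W using S(1) .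
  have Uc: "u \<in> carrier W" if "u \<in> U" for u using S(2) that by blast
  have Uminus: "u \<ominus>\<^bsub>W\<^esub> v \<in> U" if "u \<in> U" "v \<in> U" for u v
    using S(4)[OF that(1) S(5)[OF _ that(2), of "\<ominus>\<^bsub>K\<^esub> \<one>\<^bsub>K\<^esub>"]] that Uc
    by (simp add: W.smult_minus_1 W.M.minus_eq)
  define U' where "U' = {u \<oplus>\<^bsub>W\<^esub> c \<odot>\<^bsub>W\<^esub> w | u c. u \<in> U \<and> c \<in> carrier K}"
  \<comment> \<open>As \<open>w\<close> is not in \<open>U\<close>, the \<open>U\<close>-component of a vector of \<open>U + K w\<close> is well defined.\<close>
  have uniq: "u = v"
    if uv: "u \<in> U" "v \<in> U" and cd: "c \<in> carrier K" "d \<in> carrier K"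
      and e: "u \<oplus>\<^bsub>W\<^esub> c \<odot>\<^bsub>W\<^esub> w = v \<oplus>\<^bsub>W\<^esub> d \<odot>\<^bsub>W\<^esub> w" for u v c d
  proof -
    have uvc: "u \<in> carrier W" "v \<in> carrier W" using uv Uc by auto
    have "u \<ominus>\<^bsub>W\<^esub> v = (d \<ominus>\<^bsub>K\<^esub> c) \<odot>\<^bsub>W\<^esub> w"
    proof -
      have "u = v \<oplus>\<^bsub>W\<^esub> d \<odot>\<^bsub>W\<^esub> w \<ominus>\<^bsub>W\<^esub> c \<odot>\<^bsub>W\<^esub> w"
        using e uvc cd w by (metis W.M.add.inv_solve_right' W.M.minus_eq W.smult_closed W.M.a_closed)
      then show ?thesis using uvc cd w
        by (simp add: W.M.minus_eq W.R.minus_eq W.smult_l_distr W.smult_l_minus W.M.a_ac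
             W.M.r_neg1 W.M.r_neg2)
    qed
    then have 1: "(d \<ominus>\<^bsub>K\<^esub> c) \<odot>\<^bsub>W\<^esub> w \<in> U" using Uminus[OF uv] by simp
    have "d \<ominus>\<^bsub>K\<^esub> c = \<zero>\<^bsub>K\<^esub>"
    proof (rule ccontr)
      let ?k = "d \<ominus>\<^bsub>K\<^esub> c"
      assume ne: "?k \<noteq> \<zero>\<^bsub>K\<^esub>"
      have k: "?k \<in> carrier K" using cd by simp
      have i: "inv\<^bsub>K\<^esub> ?k \<in> carrier K" "inv\<^bsub>K\<^esub> ?k \<otimes>\<^bsub>K\<^esub> ?k = \<one>\<^bsub>K\<^esub>"
        using ne k W.field_Units by (auto simp: W.R.Units_l_inv)
      have "w = inv\<^bsub>K\<^esub> ?k \<odot>\<^bsub>W\<^esub> (?k \<odot>\<^bsub>W\<^esub> w)"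
        using W.smult_assoc1[OF i(1) k w] i w by simp
      then show False using S(5)[OF i(1) 1] False by simp
    qed
    then have "u \<ominus>\<^bsub>W\<^esub> v = \<zero>\<^bsub>W\<^esub>" using \<open>u \<ominus>\<^bsub>W\<^esub> v = _\<close> w by simp
    then show "u = v" by (rule vs_minus(3)[OF S(1) uvc])
  qed
  define \<eta> where "\<eta> y = \<xi> (THE u. u \<in> U \<and> (\<exists>c \<in> carrier K. y = u \<oplus>\<^bsub>W\<^esub> c \<odot>\<^bsub>W\<^esub> w))" for y
  have \<eta>: "\<eta> (u \<oplus>\<^bsub>W\<^esub> c \<odot>\<^bsub>W\<^esub> w) = \<xi> u" if "u \<in> U" "c \<in> carrier K" for u c
  proof -
    have "(THE u'. u' \<in> U \<and> (\<exists>d \<in> carrier K. u \<oplus>\<^bsub>W\<^esub> c \<odot>\<^bsub>W\<^esub> w = u' \<oplus>\<^bsub>W\<^esub> d \<odot>\<^bsub>W\<^esub> w)) = u"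
    proof (rule the_equality)
      show "u \<in> U \<and> (\<exists>d \<in> carrier K. u \<oplus>\<^bsub>W\<^esub> c \<odot>\<^bsub>W\<^esub> w = u \<oplus>\<^bsub>W\<^esub> d \<odot>\<^bsub>W\<^esub> w)"
        using that by blast
      show "u' = u" if "u' \<in> U \<and> (\<exists>d \<in> carrier K. u \<oplus>\<^bsub>W\<^esub> c \<odot>\<^bsub>W\<^esub> w = u' \<oplus>\<^bsub>W\<^esub> d \<odot>\<^bsub>W\<^esub> w)" for u'
      proof -
        from that obtain d where "u' \<in> U" "d \<in> carrier K"
          "u \<oplus>\<^bsub>W\<^esub> c \<odot>\<^bsub>W\<^esub> w = u' \<oplus>\<^bsub>W\<^esub> d \<odot>\<^bsub>W\<^esub> w" by blast
        then show ?thesis using uniq[OF \<open>u \<in> U\<close> _ \<open>c \<in> carrier K\<close>] by simp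
      qed
    qed
    then show ?thesis by (simp add: \<eta>_def)
  qed
  have add: "(u \<oplus>\<^bsub>W\<^esub> c \<odot>\<^bsub>W\<^esub> w) \<oplus>\<^bsub>W\<^esub> (v \<oplus>\<^bsub>W\<^esub> d \<odot>\<^bsub>W\<^esub> w) = (u \<oplus>\<^bsub>W\<^esub> v) \<oplus>\<^bsub>W\<^esub> (c \<oplus>\<^bsub>K\<^esub> d) \<odot>\<^bsub>W\<^esub> w"
    if "u \<in> U" "v \<in> U" "c \<in> carrier K" "d \<in> carrier K" for u v c d
    using that w Uc by (simp add: W.smult_l_distr W.M.a_ac)
  have smult: "k \<odot>\<^bsub>W\<^esub> (u \<oplus>\<^bsub>W\<^esub> c \<odot>\<^bsub>W\<^esub> w) = (k \<odot>\<^bsub>W\<^esub> u) \<oplus>\<^bsub>W\<^esub> (k \<otimes>\<^bsub>K\<^esub> c) \<odot>\<^bsub>W\<^esub> w"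
    if "u \<in> U" "k \<in> carrier K" "c \<in> carrier K" for u k c
    using that w Uc by (simp add: W.smult_r_distr W.smult_assoc1)
  have U0: "u = u \<oplus>\<^bsub>W\<^esub> \<zero>\<^bsub>K\<^esub> \<odot>\<^bsub>W\<^esub> w" if "u \<in> U" for u using Uc[OF that] w by simp
  have UU': "U \<subseteq> U'" using U0 unfolding U'_def by blast
  show ?thesis
  proof (rule that[of U' \<eta>])
    show "subspace K U' W"
    proof (rule subspaceI[OF S(1)])
      show "U' \<subseteq> carrier W" using Uc w by (auto simp: U'_def)
      show "\<zero>\<^bsub>W\<^esub> \<in> U'" using S(3) UU' by blast
      show "v \<oplus>\<^bsub>W\<^esub> v' \<in> U'" if "v \<in> U'" "v' \<in> U'" for v v'
      proof -
        obtain u c u' c' where "u \<in> U" "c \<in> carrier K" "v = u \<oplus>\<^bsub>W\<^esub> c \<odot>\<^bsub>W\<^esub> w"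
          "u' \<in> U" "c' \<in> carrier K" "v' = u' \<oplus>\<^bsub>W\<^esub> c' \<odot>\<^bsub>W\<^esub> w"
          using \<open>v \<in> U'\<close> \<open>v' \<in> U'\<close> unfolding U'_def by blast
        then show ?thesis
          using add[of u u' c c'] S(4) W.R.a_closed unfolding U'_def by blast
      qed
      show "k \<odot>\<^bsub>W\<^esub> v \<in> U'" if "k \<in> carrier K" "v \<in> U'" for k v
        using that smult S(5) W.R.m_closed unfolding U'_def by blast
    qed
    show "U \<subseteq> U'" by (rule UU')
    have "w = \<zero>\<^bsub>W\<^esub> \<oplus>\<^bsub>W\<^esub> \<one>\<^bsub>K\<^esub> \<odot>\<^bsub>W\<^esub> w" using w by simp
    then show "w \<in> U'" using S(3) W.R.one_closed unfolding U'_def by blast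
    show "\<eta> u = \<xi> u" if "u \<in> U" for u using \<eta>[OF that W.R.zero_closed] U0[OF that] by simp
    show "functional_on K W U' \<eta>"
      unfolding functional_on_def
    proof (intro conjI ballI)
      fix v assume "v \<in> U'"
      then show "\<eta> v \<in> carrier K" using f \<eta> by (auto simp: U'_def functional_on_def)
    next
      fix v v' assume "v \<in> U'" "v' \<in> U'"
      then obtain u c u' c' where *: "u \<in> U" "c \<in> carrier K" "v = u \<oplus>\<^bsub>W\<^esub> c \<odot>\<^bsub>W\<^esub> w"
          "u' \<in> U" "c' \<in> carrier K" "v' = u' \<oplus>\<^bsub>W\<^esub> c' \<odot>\<^bsub>W\<^esub> w"
        unfolding U'_def by blast
      then show "\<eta> (v \<oplus>\<^bsub>W\<^esub> v') = \<eta> v \<oplus>\<^bsub>K\<^esub> \<eta> v'"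
        using f S(4) by (simp add: add \<eta> functional_on_def)
    next
      fix k v assume "k \<in> carrier K" "v \<in> U'"
      moreover then obtain u c where *: "u \<in> U" "c \<in> carrier K" "v = u \<oplus>\<^bsub>W\<^esub> c \<odot>\<^bsub>W\<^esub> w"
        by (auto simp: U'_def)
      ultimately show "\<eta> (k \<odot>\<^bsub>W\<^esub> v) = k \<otimes>\<^bsub>K\<^esub> \<eta> v"
        using f S(5) by (simp add: smult \<eta> functional_on_def)
    qed
  qed
qed

lemma functional_on_extend_by_set:
  assumes "finite G" "G \<subseteq> carrier W" "subspace K U W" "functional_on K W U \<xi>"
  shows "\<exists>U' \<eta>. subspace K U' W \<and> U \<subseteq> U' \<and> G \<subseteq> U' \<and> functional_on K W U' \<eta> \<and>
    (\<forall>u \<in> U. \<eta> u = \<xi> u)"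
  using assms
proof (induction G rule: finite_induct)
  case empty
  then show ?case by blast
next
  case (insert w G)
  then obtain U' \<eta> where *: "subspace K U' W" "U \<subseteq> U'" "G \<subseteq> U'" "functional_on K W U' \<eta>"
    "\<forall>u \<in> U. \<eta> u = \<xi> u" by auto
  obtain U'' \<zeta> where "subspace K U'' W" "U' \<subseteq> U''" "w \<in> U''" "functional_on K W U'' \<zeta>"
    "\<And>u. u \<in> U' \<Longrightarrow> \<zeta> u = \<eta> u"
    using functional_on_extend_by_vector[OF *(1,4), of w] insert.prems by blast
  with * show ?case by (intro exI[of _ U''] exI[of _ \<zeta>]) (auto simp: subset_iff)
qed

lemma functional_extends_along_injection:
  fixes W :: "('k, 'w) module"
  assumes T: "linear_map K V W T" and i: "inj_on T (carrier V)"
    and fd: "vectorspace.fin_dim K W" and \<xi>: "linear_map K V (scalar_space K) \<xi>"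
  obtains \<eta> where "linear_map K W (scalar_space K) \<eta>" "\<And>v. v \<in> carrier V \<Longrightarrow> \<eta> (T v) = \<xi> v"
proof -
  note D = linear_mapD[OF T] and X = linear_mapD[OF \<xi>]
  interpret V: vectorspace K V using D(1) .
  interpret W: vectorspace K W using D(2) .
  define U where "U = T ` carrier V"
  have "subspace K (carrier V) V" by (rule subspaceI[OF D(1)]) auto
  then have U: "subspace K U W" unfolding U_def by (rule image_subspace[OF T])
  define \<xi>' where "\<xi>' w = \<xi> (inv_into (carrier V) T w)" for w
  have \<xi>': "\<xi>' (T v) = \<xi> v" if "v \<in> carrier V" for v using that i by (simp add: \<xi>'_def)
  have f: "functional_on K W U \<xi>'"
    using X by (auto simp: functional_on_def U_def \<xi>' D(4,5)[symmetric])
  obtain G where G: "finite G" "G \<subseteq> carrier W" "W.span G = carrier W"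
    using fd unfolding W.fin_dim_def by blast
  obtain U' \<eta> where *: "subspace K U' W" "G \<subseteq> U'" "functional_on K W U' \<eta>" "\<forall>u \<in> U. \<eta> u = \<xi>' u"
    using functional_on_extend_by_set[OF G(1,2) U f] by blast
  have "submodule K U' W" using *(1) by (simp add: VectorSpace.subspace_def)
  then have "U' = carrier W"
    using W.span_is_subset[OF *(2)] G(3) subspaceD(2)[OF *(1)] by auto
  then have "linear_map K W (scalar_space K) \<eta>"
    using *(3) by (intro linear_mapI[OF D(2) X(2)]) (auto simp: functional_on_def)
  then show ?thesis using that *(4) \<xi>' by (auto simp: U_def)
qed


section \<open>Homomorphisms and functoriality\<close>

lemma identity_rep_simps [simp]:
  "vspace (identity_rep K) x = scalar_space K" "vmap (identity_rep K) a v = v"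
  by (simp_all add: identity_rep_def scalar_space_def)

lemma is_repD:
  assumes "is_rep K Q V"
  shows "x \<in> verts Q \<Longrightarrow> vectorspace K (vspace V x)"
    and "x \<in> verts Q \<Longrightarrow> vectorspace.fin_dim K (vspace V x)"
    and "a \<in> arcs Q \<Longrightarrow> linear_map K (vspace V (tail Q a)) (vspace V (head Q a)) (vmap V a)"
    and "a \<in> arcs Q \<Longrightarrow> v \<in> carrier (vspace V (tail Q a)) \<Longrightarrow>
           vmap V a v \<in> carrier (vspace V (head Q a))"
proof -
  show "x \<in> verts Q \<Longrightarrow> vectorspace K (vspace V x)"
    "x \<in> verts Q \<Longrightarrow> vectorspace.fin_dim K (vspace V x)"
    and *: "a \<in> arcs Q \<Longrightarrow> linear_map K (vspace V (tail Q a)) (vspace V (head Q a)) (vmap V a)"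
    using assms by (simp_all add: is_rep_def)
  show "a \<in> arcs Q \<Longrightarrow> v \<in> carrier (vspace V (tail Q a)) \<Longrightarrow>
           vmap V a v \<in> carrier (vspace V (head Q a))"
    using linear_mapD(3)[OF *] .
qed

lemma rep_homD:
  assumes "rep_hom K Q V W \<phi>"
  shows "x \<in> verts Q \<Longrightarrow> linear_map K (vspace V x) (vspace W x) (\<phi> x)"
    and "a \<in> arcs Q \<Longrightarrow> v \<in> carrier (vspace V (tail Q a)) \<Longrightarrow>
           \<phi> (head Q a) (vmap V a v) = vmap W a (\<phi> (tail Q a) v)"
  using assms by (simp_all add: rep_hom_def)

lemma rep_hom_comp:
  assumes Q: "wf_digraph Q" and \<phi>: "rep_hom K Q U V \<phi>" and \<psi>: "rep_hom K Q V W \<psi>"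
  shows "rep_hom K Q U W (\<lambda>x u. \<psi> x (\<phi> x u))"
  unfolding rep_hom_def
proof (intro conjI ballI)
  interpret wf_digraph Q by fact
  fix x assume "x \<in> verts Q"
  then show "linear_map K (vspace U x) (vspace W x) (\<lambda>u. \<psi> x (\<phi> x u))"
    using linear_map_comp rep_homD(1)[OF \<phi>] rep_homD(1)[OF \<psi>] by blast
next
  interpret wf_digraph Q by fact
  fix a u assume a: "a \<in> arcs Q" and u: "u \<in> carrier (vspace U (tail Q a))"
  have "\<phi> (tail Q a) u \<in> carrier (vspace V (tail Q a))"
    using linear_mapD(3)[OF rep_homD(1)[OF \<phi>]] a u by simp
  then show "\<psi> (head Q a) (\<phi> (head Q a) (vmap U a u)) = vmap W a (\<psi> (tail Q a) (\<phi> (tail Q a) u))"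
    using rep_homD(2)[OF \<phi> a u] rep_homD(2)[OF \<psi> a] by simp
qed

lemma rep_hom_inverse:
  assumes V: "is_rep K Q V" and Q: "wf_digraph Q" and \<phi>: "rep_hom K Q V W \<phi>"
    and b: "\<And>x. x \<in> verts Q \<Longrightarrow> bij_betw (\<phi> x) (carrier (vspace V x)) (carrier (vspace W x))"
  shows "rep_hom K Q W V (\<lambda>x. inv_into (carrier (vspace V x)) (\<phi> x))"
  unfolding rep_hom_def
proof (intro conjI ballI)
  fix x assume "x \<in> verts Q"
  then show "linear_map K (vspace W x) (vspace V x) (inv_into (carrier (vspace V x)) (\<phi> x))"
    using linear_map_inv_into rep_homD(1)[OF \<phi>] b by blast
next
  interpret wf_digraph Q by fact
  fix a w assume a: "a \<in> arcs Q" and w: "w \<in> carrier (vspace W (tail Q a))"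
  let ?t = "tail Q a" and ?h = "head Q a"
  define v where "v = inv_into (carrier (vspace V ?t)) (\<phi> ?t) w"
  have v: "v \<in> carrier (vspace V ?t)" "\<phi> ?t v = w"
    using b[of ?t] w a by (auto simp: v_def bij_betw_def inv_into_into f_inv_into_f)
  have "inv_into (carrier (vspace V ?h)) (\<phi> ?h) (\<phi> ?h (vmap V a v)) = vmap V a v"
    using b[of ?h] is_repD(4)[OF V a v(1)] a by (simp add: bij_betw_def)
  then show "inv_into (carrier (vspace V ?h)) (\<phi> ?h) (vmap W a w)
      = vmap V a (inv_into (carrier (vspace V ?t)) (\<phi> ?t) w)"
    using rep_homD(2)[OF \<phi> a v(1)] v(2) by (simp add: v_def)
qed

lemma image_is_subrep:
  assumes Q: "wf_digraph Q" and \<phi>: "rep_hom K Q V W \<phi>" and S: "is_subrep K Q V S"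
  shows "is_subrep K Q W (\<lambda>x. \<phi> x ` S x)"
  unfolding is_subrep_def
proof (intro conjI ballI)
  fix x assume "x \<in> verts Q"
  then show "subspace K (\<phi> x ` S x) (vspace W x)"
    using image_subspace[OF rep_homD(1)[OF \<phi>]] S by (simp add: is_subrep_def)
next
  interpret wf_digraph Q by fact
  fix a assume a: "a \<in> arcs Q"
  have "vmap V a ` S (tail Q a) \<subseteq> S (head Q a)" "subspace K (S (tail Q a)) (vspace V (tail Q a))"
    using S a by (simp_all add: is_subrep_def)
  moreover from this have "S (tail Q a) \<subseteq> carrier (vspace V (tail Q a))" by (intro subspaceD(2))
  ultimately show "vmap W a ` \<phi> (tail Q a) ` S (tail Q a) \<subseteq> \<phi> (head Q a) ` S (head Q a)"
    using rep_homD(2)[OF \<phi> a, symmetric] by (auto simp: subset_iff)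
qed

lemma preimage_is_subrep:
  assumes V: "is_rep K Q V" and Q: "wf_digraph Q" and \<phi>: "rep_hom K Q V W \<phi>"
    and S: "is_subrep K Q W S"
  shows "is_subrep K Q V (\<lambda>x. {v \<in> carrier (vspace V x). \<phi> x v \<in> S x})"
  unfolding is_subrep_def
proof (intro conjI ballI)
  fix x assume "x \<in> verts Q"
  then show "subspace K {v \<in> carrier (vspace V x). \<phi> x v \<in> S x} (vspace V x)"
    using preimage_subspace[OF rep_homD(1)[OF \<phi>]] S by (simp add: is_subrep_def)
next
  fix a assume a: "a \<in> arcs Q"
  have "vmap W a ` S (tail Q a) \<subseteq> S (head Q a)"
    using S a by (simp add: is_subrep_def)
  then show "vmap V a ` {v \<in> carrier (vspace V (tail Q a)). \<phi> (tail Q a) v \<in> S (tail Q a)}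
      \<subseteq> {v \<in> carrier (vspace V (head Q a)). \<phi> (head Q a) v \<in> S (head Q a)}"
    using rep_homD(2)[OF \<phi> a] is_repD(4)[OF V a] by auto
qed

lemma zero_is_subrep:
  assumes V: "is_rep K Q V" and Q: "wf_digraph Q"
  shows "is_subrep K Q V (\<lambda>x. {\<zero>\<^bsub>vspace V x\<^esub>})"
  unfolding is_subrep_def
proof (intro conjI ballI)
  fix x assume x: "x \<in> verts Q"
  interpret vectorspace K "vspace V x" using is_repD(1)[OF V x] .
  show "subspace K {\<zero>\<^bsub>vspace V x\<^esub>} (vspace V x)"
    by (rule subspaceI[OF is_repD(1)[OF V x]]) auto
next
  fix a assume a: "a \<in> arcs Q"
  show "vmap V a ` {\<zero>\<^bsub>vspace V (tail Q a)\<^esub>} \<subseteq> {\<zero>\<^bsub>vspace V (head Q a)\<^esub>}"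
    using linear_mapD(6)[OF is_repD(3)[OF V a]] by simp
qed

lemma carrier_is_subrep:
  assumes V: "is_rep K Q V"
  shows "is_subrep K Q V (\<lambda>x. carrier (vspace V x))"
  unfolding is_subrep_def
proof (intro conjI ballI)
  fix x assume x: "x \<in> verts Q"
  interpret vectorspace K "vspace V x" using is_repD(1)[OF V x] .
  show "subspace K (carrier (vspace V x)) (vspace V x)"
    by (rule subspaceI[OF is_repD(1)[OF V x]]) auto
next
  fix a assume a: "a \<in> arcs Q"
  show "vmap V a ` carrier (vspace V (tail Q a)) \<subseteq> carrier (vspace V (head Q a))"
    using is_repD(4)[OF V a] by blast
qed

lemma epi_part_subset:
  assumes V: "is_rep K Q V" and Q: "fin_digraph Q" and x: "x \<in> verts Q"
  shows "epi_part K Q V x \<subseteq> carrier (vspace V x)"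
  using epi_part_greatest(1)[OF V Q] x subspaceD(2) unfolding is_subrep_def by blast

lemma vmap_epi_part:
  assumes V: "is_rep K Q V" and Q: "fin_digraph Q" and a: "a \<in> arcs Q"
  shows "vmap V a ` epi_part K Q V (tail Q a) = epi_part K Q V (head Q a)"
  using epi_part_greatest(2)[OF V Q] a by (simp add: epimorphic_rep_def sub_rep_def)

lemma epi_part_greatestI:
  assumes V: "is_rep K Q V" and Q: "fin_digraph Q" and S: "is_subrep K Q V S"
    and s: "\<And>a. a \<in> arcs Q \<Longrightarrow> S (head Q a) \<subseteq> vmap V a ` S (tail Q a)"
    and x: "x \<in> verts Q"
  shows "S x \<subseteq> epi_part K Q V x"
proof (rule epi_part_greatest(3)[OF V Q S _ x])
  show "epimorphic_rep Q (sub_rep V S)"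
    using S s by (simp add: epimorphic_rep_def sub_rep_def is_subrep_def subset_antisym)
qed

lemma epi_part_epimorphic:
  assumes V: "is_rep K Q V" and Q: "fin_digraph Q" and e: "epimorphic_rep Q V" and x: "x \<in> verts Q"
  shows "epi_part K Q V x = carrier (vspace V x)"
  using epi_part_subset[OF V Q x] epi_part_greatestI[OF V Q carrier_is_subrep[OF V] _ x] e
  by (auto simp: epimorphic_rep_def)

lemma mono_kernel_reflects:
  assumes V: "is_rep K Q V" and Q: "fin_digraph Q" and a: "a \<in> arcs Q"
    and v: "v \<in> carrier (vspace V (tail Q a))" "vmap V a v \<in> mono_kernel K Q V (head Q a)"
  shows "v \<in> mono_kernel K Q V (tail Q a)"
  using monomorphic_quot_iff[OF V Q mono_quot_universal(1)[OF V Q]]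
    mono_quot_universal(2)[OF V Q] a v by (simp add: mono_quot_def)

lemma mono_kernel_leastI:
  assumes V: "is_rep K Q V" and Q: "fin_digraph Q" and N: "is_subrep K Q V N"
    and n: "\<And>a v. a \<in> arcs Q \<Longrightarrow> v \<in> carrier (vspace V (tail Q a)) \<Longrightarrow>
           vmap V a v \<in> N (head Q a) \<Longrightarrow> v \<in> N (tail Q a)"
  shows "mono_kernel K Q V x \<subseteq> N x"
  unfolding mono_kernel_def using N n monomorphic_quot_iff[OF V Q N] by blast

lemma mono_kernel_zero:
  assumes V: "is_rep K Q V" and Q: "fin_digraph Q" and x: "x \<in> verts Q"
  shows "\<zero>\<^bsub>vspace V x\<^esub> \<in> mono_kernel K Q V x"
  using mono_quot_universal(1)[OF V Q] x subspaceD(3) unfolding is_subrep_def by blast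

lemma mono_kernel_monomorphic:
  assumes V: "is_rep K Q V" and Q: "fin_digraph Q" and m: "monomorphic_rep Q V" and x: "x \<in> verts Q"
  shows "mono_kernel K Q V x = {\<zero>\<^bsub>vspace V x\<^esub>}"
proof -
  interpret fin_digraph Q by fact
  have "mono_kernel K Q V x \<subseteq> {\<zero>\<^bsub>vspace V x\<^esub>}"
  proof (rule mono_kernel_leastI[OF V Q zero_is_subrep[OF V]])
    show "wf_digraph Q" ..
    fix a v assume a: "a \<in> arcs Q" and v: "v \<in> carrier (vspace V (tail Q a))"
      "vmap V a v \<in> {\<zero>\<^bsub>vspace V (head Q a)\<^esub>}"
    interpret T: vectorspace K "vspace V (tail Q a)" using is_repD(1)[OF V] a by simp
    have "vmap V a v = vmap V a \<zero>\<^bsub>vspace V (tail Q a)\<^esub>"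
      using v linear_mapD(6)[OF is_repD(3)[OF V a]] by simp
    then show "v \<in> {\<zero>\<^bsub>vspace V (tail Q a)\<^esub>}"
      using m a v(1) unfolding monomorphic_rep_def inj_on_def by blast
  qed
  then show ?thesis using mono_kernel_zero[OF V Q x] by blast
qed

text \<open>
  Homomorphisms preserve both the maximal epimorphic part and the kernel of the maximal
  monomorphic quotient.
\<close>

lemma epi_part_hom:
  assumes V: "is_rep K Q V" and W: "is_rep K Q W" and Q: "fin_digraph Q"
    and \<phi>: "rep_hom K Q V W \<phi>" and x: "x \<in> verts Q" and v: "v \<in> epi_part K Q V x"
  shows "\<phi> x v \<in> epi_part K Q W x"
proof -
  interpret fin_digraph Q by fact
  have wf: "wf_digraph Q" ..
  have "\<phi> x ` epi_part K Q V x \<subseteq> epi_part K Q W x"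
  proof (rule epi_part_greatestI[OF W Q image_is_subrep[OF wf \<phi> epi_part_greatest(1)[OF V Q]] _ x])
    fix a assume a: "a \<in> arcs Q"
    have "epi_part K Q V (tail Q a) \<subseteq> carrier (vspace V (tail Q a))"
      using epi_part_subset[OF V Q] a by simp
    then show "\<phi> (head Q a) ` epi_part K Q V (head Q a)
        \<subseteq> vmap W a ` \<phi> (tail Q a) ` epi_part K Q V (tail Q a)"
      unfolding vmap_epi_part[OF V Q a, symmetric] using rep_homD(2)[OF \<phi> a] by (auto simp: subset_iff)
  qed
  then show ?thesis using v by blast
qed

lemma mono_kernel_hom:
  assumes V: "is_rep K Q V" and W: "is_rep K Q W" and Q: "fin_digraph Q"
    and \<phi>: "rep_hom K Q V W \<phi>" and v: "v \<in> mono_kernel K Q V x"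
  shows "\<phi> x v \<in> mono_kernel K Q W x"
proof -
  interpret fin_digraph Q by fact
  have wf: "wf_digraph Q" ..
  have "mono_kernel K Q V x \<subseteq> {v \<in> carrier (vspace V x). \<phi> x v \<in> mono_kernel K Q W x}"
  proof (rule mono_kernel_leastI[OF V Q preimage_is_subrep[OF V wf \<phi> mono_quot_universal(1)[OF W Q]]])
    fix a v assume a: "a \<in> arcs Q" and v: "v \<in> carrier (vspace V (tail Q a))"
      and h: "vmap V a v \<in> {v \<in> carrier (vspace V (head Q a)). \<phi> (head Q a) v \<in> mono_kernel K Q W (head Q a)}"
    have "\<phi> (tail Q a) v \<in> carrier (vspace W (tail Q a))"
      using linear_mapD(3)[OF rep_homD(1)[OF \<phi>]] a v by simp
    then show "v \<in> {v \<in> carrier (vspace V (tail Q a)). \<phi> (tail Q a) v \<in> mono_kernel K Q W (tail Q a)}"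
      using h v rep_homD(2)[OF \<phi> a v] mono_kernel_reflects[OF W Q a] by simp
  qed
  then show ?thesis using v by blast
qed

lemma quot_proj_eq_zero_iff:
  assumes V: "is_rep K Q V" and Q: "fin_digraph Q" and N: "is_subrep K Q V N"
    and x: "x \<in> verts Q" and v: "v \<in> carrier (vspace V x)"
  shows "quot_proj V N x v = \<zero>\<^bsub>vspace (quot_rep Q V N) x\<^esub> \<longleftrightarrow> v \<in> N x"
proof -
  interpret vectorspace K "vspace V x" using is_repD(1)[OF V x] .
  have s: "subspace K (N x) (vspace V x)" using N x by (simp add: is_subrep_def)
  have z: "quot_proj V N x \<zero>\<^bsub>vspace V x\<^esub> = \<zero>\<^bsub>vspace (quot_rep Q V N) x\<^esub>"
    using linear_mapD(6)[OF rep_homD(1)[OF quot_rep_is_rep(2)[OF V Q N] x]] .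
  have "quot_proj V N x v = quot_proj V N x \<zero>\<^bsub>vspace V x\<^esub> \<longleftrightarrow> v \<in> N x"
    using coset_eq_iff[OF s v M.zero_closed] vs_minus(1)[OF is_repD(1)[OF V x] v]
    by (simp add: quot_proj_def)
  then show ?thesis unfolding z .
qed

lemma carrier_global_tensor:
  "carrier (vspace (global_tensor K Q V) x) =
     quot_proj V (mono_kernel K Q V) x ` epi_part K Q V x"
  by (simp add: global_tensor_def sub_rep_def)

lemma zero_global_tensor_iff:
  assumes V: "is_rep K Q V" and Q: "fin_digraph Q"
  shows "zero_rep Q (global_tensor K Q V) \<longleftrightarrow>
    (\<forall>x \<in> verts Q. epi_part K Q V x \<subseteq> mono_kernel K Q V x)"
proof -
  have "quot_proj V (mono_kernel K Q V) x ` epi_part K Q V x = {\<zero>\<^bsub>vspace (mono_quot K Q V) x\<^esub>}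
      \<longleftrightarrow> epi_part K Q V x \<subseteq> mono_kernel K Q V x" if x: "x \<in> verts Q" for x
  proof -
    have "epi_part K Q V x \<noteq> {}"
      using epi_part_greatest(1)[OF V Q] x subspaceD(3) unfolding is_subrep_def by blast
    moreover have "quot_proj V (mono_kernel K Q V) x v = \<zero>\<^bsub>vspace (mono_quot K Q V) x\<^esub>
        \<longleftrightarrow> v \<in> mono_kernel K Q V x" if "v \<in> epi_part K Q V x" for v
      unfolding mono_quot_def
      using quot_proj_eq_zero_iff[OF V Q mono_quot_universal(1)[OF V Q] x] epi_part_subset[OF V Q x] that
      by blast
    ultimately show ?thesis by (auto simp: subset_iff image_iff)
  qed
  moreover have "\<zero>\<^bsub>vspace (global_tensor K Q V) x\<^esub> = \<zero>\<^bsub>vspace (mono_quot K Q V) x\<^esub>" for x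
    by (simp add: global_tensor_def sub_rep_def)
  ultimately show ?thesis by (simp add: zero_rep_def carrier_global_tensor)
qed

lemma iso_identity_rep_epi_mono:
  assumes V: "is_rep K Q V" and Q: "wf_digraph Q" and i: "rep_iso K Q V (identity_rep K)"
  shows "epimorphic_rep Q V" "monomorphic_rep Q V"
proof -
  interpret wf_digraph Q by fact
  obtain \<phi> where \<phi>: "rep_hom K Q V (identity_rep K) \<phi>"
    and b: "\<And>x. x \<in> verts Q \<Longrightarrow> bij_betw (\<phi> x) (carrier (vspace V x)) (carrier K)"
    using i by (auto simp: rep_iso_def)
  have c: "\<phi> (head Q a) (vmap V a v) = \<phi> (tail Q a) v"
    if "a \<in> arcs Q" "v \<in> carrier (vspace V (tail Q a))" for a v
    using rep_homD(2)[OF \<phi> that] by simp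
  show "monomorphic_rep Q V"
    unfolding monomorphic_rep_def
  proof
    fix a assume a: "a \<in> arcs Q"
    have "inj_on (\<phi> (tail Q a)) (carrier (vspace V (tail Q a)))" using b a by (simp add: bij_betw_def)
    then show "inj_on (vmap V a) (carrier (vspace V (tail Q a)))"
      using c[OF a] unfolding inj_on_def by metis
  qed
  show "epimorphic_rep Q V"
    unfolding epimorphic_rep_def
  proof (intro ballI equalityI subsetI)
    fix a w assume a: "a \<in> arcs Q"
    show "w \<in> carrier (vspace V (head Q a))" if "w \<in> vmap V a ` carrier (vspace V (tail Q a))"
      using that is_repD(4)[OF V a] by blast
    assume w: "w \<in> carrier (vspace V (head Q a))"
    then have "\<phi> (head Q a) w \<in> \<phi> (tail Q a) ` carrier (vspace V (tail Q a))"
      using b[of "head Q a"] b[of "tail Q a"] a by (auto simp: bij_betw_def)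
    then obtain v where v: "v \<in> carrier (vspace V (tail Q a))" "\<phi> (head Q a) w = \<phi> (tail Q a) v" by blast
    then have "\<phi> (head Q a) (vmap V a v) = \<phi> (head Q a) w" using c[OF a] by simp
    then have "vmap V a v = w"
      using b[of "head Q a"] a w is_repD(4)[OF V a v(1)] by (auto simp: bij_betw_def dest: inj_onD)
    then show "w \<in> vmap V a ` carrier (vspace V (tail Q a))" using v by blast
  qed
qed


section \<open>Splitting off the identity representation\<close>

lemma scalar_multiples_linear:
  assumes V: "vectorspace K V" and v: "v \<in> carrier V"
  shows "linear_map K (scalar_space K) V (\<lambda>c. c \<odot>\<^bsub>V\<^esub> v)"
proof -
  interpret vectorspace K V by fact
  have "field K" ..
  then show ?thesis
    using v V
    by (intro linear_mapI scalar_space_vectorspace) (simp_all add: smult_l_distr smult_assoc1)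
qed

text \<open>
  A homomorphism from the identity representation is a family of vectors that the arrows map
  to each other.
\<close>

lemma hom_from_identity_rep:
  assumes K: "field K" and Q: "fin_digraph Q" and T: "tree_quiver Q" and V: "is_rep K Q V"
    and r: "r \<in> verts Q" and u: "u \<in> epi_part K Q V r"
  obtains \<sigma> where "rep_hom K Q (identity_rep K) V \<sigma>" "\<sigma> r \<one>\<^bsub>K\<^esub> = u"
proof -
  interpret fin_digraph Q by fact
  obtain s where s: "s r = u" "\<And>x. x \<in> verts Q \<Longrightarrow> s x \<in> epi_part K Q V x"
    "\<And>a. a \<in> arcs Q \<Longrightarrow> vmap V a (s (tail Q a)) = s (head Q a)"
  proof (rule tree_compatible_family[OF Q T, where A = "epi_part K Q V" and
        R = "\<lambda>a v w. vmap V a v = w" and r = r and u = u])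
    fix a
    show "\<exists>w\<in>epi_part K Q V (head Q a). vmap V a v = w"
      if "a \<in> arcs Q" "v \<in> epi_part K Q V (tail Q a)" for v
      using vmap_epi_part[OF V Q that(1)] that(2) by blast
    show "\<exists>v\<in>epi_part K Q V (tail Q a). vmap V a v = w"
      if "a \<in> arcs Q" "w \<in> epi_part K Q V (head Q a)" for w
      using that(2) unfolding vmap_epi_part[OF V Q that(1), symmetric] by blast
  qed (use r u in auto)
  have sc: "s x \<in> carrier (vspace V x)" if "x \<in> verts Q" for x
    using s(2)[OF that] epi_part_subset[OF V Q that] by blast
  have "rep_hom K Q (identity_rep K) V (\<lambda>x c. c \<odot>\<^bsub>vspace V x\<^esub> s x)"
    unfolding rep_hom_def
  proof (intro conjI ballI)
    fix x assume x: "x \<in> verts Q"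
    show "linear_map K (vspace (identity_rep K) x) (vspace V x) (\<lambda>c. c \<odot>\<^bsub>vspace V x\<^esub> s x)"
      using scalar_multiples_linear[OF is_repD(1)[OF V x] sc[OF x]] by simp
  next
    fix a c assume a: "a \<in> arcs Q" and c: "c \<in> carrier (vspace (identity_rep K) (tail Q a))"
    show "vmap (identity_rep K) a c \<odot>\<^bsub>vspace V (head Q a)\<^esub> s (head Q a)
        = vmap V a (c \<odot>\<^bsub>vspace V (tail Q a)\<^esub> s (tail Q a))"
      using linear_mapD(5)[OF is_repD(3)[OF V a]] sc a c s(3)[OF a] by simp
  qed
  moreover have "\<one>\<^bsub>K\<^esub> \<odot>\<^bsub>vspace V r\<^esub> s r = u"
  proof -
    interpret vectorspace K "vspace V r" using is_repD(1)[OF V r] .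
    show ?thesis using sc[OF r] s(1) by simp
  qed
  ultimately show ?thesis using that by blast
qed

text \<open>
  A homomorphism to the identity representation is a family of functionals, each of which is
  the pullback, along an arrow out of its vertex, of the functional at the head.  On the
  monomorphic quotient, functionals pull back and also extend along every arrow.
\<close>

lemma hom_to_identity_rep:
  assumes K: "field K" and Q: "fin_digraph Q" and T: "tree_quiver Q" and V: "is_rep K Q V"
    and r: "r \<in> verts Q" and v: "v \<in> carrier (vspace V r)" "v \<notin> mono_kernel K Q V r"
  obtains \<xi> where "rep_hom K Q V (identity_rep K) \<xi>" "\<xi> r v = \<one>\<^bsub>K\<^esub>"
proof -
  interpret fin_digraph Q by fact
  interpret K: field K by fact
  have wf: "wf_digraph Q" ..
  let ?M = "mono_quot K Q V" and ?p = "quot_proj V (mono_kernel K Q V)"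
  note N = mono_quot_universal(1)[OF V Q] and inj = mono_quot_universal(2)[OF V Q]
  note M = quot_rep_is_rep(1,2)[OF V Q N, folded mono_quot_def]
  have pv: "?p r v \<in> carrier (vspace ?M r)" "?p r v \<noteq> \<zero>\<^bsub>vspace ?M r\<^esub>"
    using linear_mapD(3)[OF rep_homD(1)[OF M(2) r] v(1)] quot_proj_eq_zero_iff[OF V Q N r v(1)] v(2)
    by (simp_all add: mono_quot_def)
  interpret Mr: vectorspace K "vspace ?M r" using is_repD(1)[OF M(1) r] .
  \<comment> \<open>A functional with value 1 on the class of \<open>v\<close> extends the identity along \<open>c \<mapsto> c v\<close>.\<close>
  have "inj_on (\<lambda>c. c \<odot>\<^bsub>vspace ?M r\<^esub> ?p r v) (carrier (scalar_space K))"
  proof (rule linear_map_inj_onI[OF scalar_multiples_linear[OF is_repD(1)[OF M(1) r] pv(1)]])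
    fix c assume c: "c \<in> carrier (scalar_space K)"
      and z: "c \<odot>\<^bsub>vspace ?M r\<^esub> ?p r v = \<zero>\<^bsub>vspace ?M r\<^esub>"
    show "c = \<zero>\<^bsub>scalar_space K\<^esub>"
    proof (rule ccontr)
      assume ne: "c \<noteq> \<zero>\<^bsub>scalar_space K\<^esub>"
      have i: "inv\<^bsub>K\<^esub> c \<in> carrier K" "inv\<^bsub>K\<^esub> c \<otimes>\<^bsub>K\<^esub> c = \<one>\<^bsub>K\<^esub>"
        using ne c K.field_Units by (auto simp: K.Units_l_inv)
      have "?p r v = inv\<^bsub>K\<^esub> c \<odot>\<^bsub>vspace ?M r\<^esub> (c \<odot>\<^bsub>vspace ?M r\<^esub> ?p r v)"
        using Mr.smult_assoc1[OF i(1) _ pv(1), of c] i c pv by simp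
      then show False using z i pv by simp
    qed
  qed
  then obtain \<eta> where \<eta>: "linear_map K (vspace ?M r) (scalar_space K) \<eta>"
    "\<And>c. c \<in> carrier K \<Longrightarrow> \<eta> (c \<odot>\<^bsub>vspace ?M r\<^esub> ?p r v) = c"
    using functional_extends_along_injection[OF
        scalar_multiples_linear[OF is_repD(1)[OF M(1) r] pv(1)] _ is_repD(2)[OF M(1) r],
        of "\<lambda>c. c"] scalar_space_vectorspace[OF K] linear_mapI[of K "scalar_space K" "scalar_space K" "\<lambda>c. c"]
    by (metis scalar_space_simps(1))
  have \<eta>v: "\<eta> (?p r v) = \<one>\<^bsub>K\<^esub>" using \<eta>(2)[of "\<one>\<^bsub>K\<^esub>"] pv by simp
  obtain s where s: "s r = \<eta>"
    "\<And>x. x \<in> verts Q \<Longrightarrow> linear_map K (vspace ?M x) (scalar_space K) (s x)"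
    "\<And>a. a \<in> arcs Q \<Longrightarrow> \<forall>u \<in> carrier (vspace ?M (tail Q a)). s (head Q a) (vmap ?M a u) = s (tail Q a) u"
  proof (rule tree_compatible_family[OF Q T, where r = r and u = \<eta> and
        A = "\<lambda>x. {\<xi>. linear_map K (vspace ?M x) (scalar_space K) \<xi>}" and
        R = "\<lambda>a \<xi> \<zeta>. \<forall>u \<in> carrier (vspace ?M (tail Q a)). \<zeta> (vmap ?M a u) = \<xi> u"])
    fix a \<xi> assume a: "a \<in> arcs Q" and "\<xi> \<in> {\<xi>. linear_map K (vspace ?M (tail Q a)) (scalar_space K) \<xi>}"
    then have \<xi>: "linear_map K (vspace ?M (tail Q a)) (scalar_space K) \<xi>" by simp
    have h: "head Q a \<in> verts Q" using a by simp
    have i: "inj_on (vmap ?M a) (carrier (vspace ?M (tail Q a)))"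
      using inj a by (simp add: monomorphic_rep_def)
    show "\<exists>\<zeta>\<in>{\<zeta>. linear_map K (vspace ?M (head Q a)) (scalar_space K) \<zeta>}.
        \<forall>u\<in>carrier (vspace ?M (tail Q a)). \<zeta> (vmap ?M a u) = \<xi> u"
      by (rule functional_extends_along_injection[OF is_repD(3)[OF M(1) a] i is_repD(2)[OF M(1) h] \<xi>])
        blast
  next
    fix a \<zeta> assume a: "a \<in> arcs Q" and "\<zeta> \<in> {\<zeta>. linear_map K (vspace ?M (head Q a)) (scalar_space K) \<zeta>}"
    then have "linear_map K (vspace ?M (tail Q a)) (scalar_space K) (\<lambda>u. \<zeta> (vmap ?M a u))"
      using linear_map_comp[OF is_repD(3)[OF M(1) a]] by simp
    then show "\<exists>\<xi>\<in>{\<xi>. linear_map K (vspace ?M (tail Q a)) (scalar_space K) \<xi>}.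
        \<forall>u\<in>carrier (vspace ?M (tail Q a)). \<zeta> (vmap ?M a u) = \<xi> u"
      by (intro bexI[of _ "\<lambda>u. \<zeta> (vmap ?M a u)"]) auto
  qed (use r \<eta>(1) in auto)
  have "rep_hom K Q ?M (identity_rep K) s"
    using s(2,3) by (simp add: rep_hom_def)
  then have "rep_hom K Q V (identity_rep K) (\<lambda>x v. s x (?p x v))"
    by (rule rep_hom_comp[OF wf M(2)])
  moreover have "s r (?p r v) = \<one>\<^bsub>K\<^esub>" using s(1) \<eta>v by simp
  ultimately show ?thesis using that by blast
qed

text \<open>
  A pair of homomorphisms from and to the identity representation whose composition is the
  identity at one vertex exhibits the identity representation as a direct summand, because the
  composition is the same scalar at all vertices of a connected quiver.
\<close>

lemma indecomposable_iso_identity_rep: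
  assumes K: "field K" and Q: "wf_digraph Q" and c: "connected Q"
    and V: "indecomposable_rep K Q V"
    and \<sigma>: "rep_hom K Q (identity_rep K) V \<sigma>" and \<xi>: "rep_hom K Q V (identity_rep K) \<xi>"
    and r: "r \<in> verts Q" "\<xi> r (\<sigma> r \<one>\<^bsub>K\<^esub>) = \<one>\<^bsub>K\<^esub>"
  shows "rep_iso K Q V (identity_rep K)"
proof -
  interpret wf_digraph Q by fact
  interpret K: field K by fact
  have Vr: "is_rep K Q V" using V by (simp add: indecomposable_rep_def)
  note s = linear_mapD[OF rep_homD(1)[OF \<sigma>], simplified]
  note x = linear_mapD[OF rep_homD(1)[OF \<xi>], simplified]
  have step: "\<xi> (head Q a) (\<sigma> (head Q a) \<one>\<^bsub>K\<^esub>) = \<xi> (tail Q a) (\<sigma> (tail Q a) \<one>\<^bsub>K\<^esub>)"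
    if a: "a \<in> arcs Q" for a
    using rep_homD(2)[OF \<sigma> a, of "\<one>\<^bsub>K\<^esub>"] rep_homD(2)[OF \<xi> a, of "\<sigma> (tail Q a) \<one>\<^bsub>K\<^esub>"]
      s(3)[of "tail Q a" "\<one>\<^bsub>K\<^esub>"] a by simp
  have one: "\<xi> y (\<sigma> y \<one>\<^bsub>K\<^esub>) = \<one>\<^bsub>K\<^esub>" if y: "y \<in> verts Q" for y
  proof -
    have "(r, y) \<in> (adj_rel Q (arcs Q))\<^sup>*" using c r y connected_iff_adj_rel[OF Q] by blast
    then show ?thesis
      by induction (use r step in \<open>auto simp: adj_rel_def\<close>)
  qed
  have id: "\<xi> y (\<sigma> y k) = k" if y: "y \<in> verts Q" and k: "k \<in> carrier K" for y k
  proof -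
    have "\<sigma> y k = k \<odot>\<^bsub>vspace V y\<^esub> \<sigma> y \<one>\<^bsub>K\<^esub>" using s(5)[OF y k K.one_closed] k by simp
    then show ?thesis using x(5)[OF y k s(3)[OF y K.one_closed]] one[OF y] k by simp
  qed
  \<comment> \<open>The summands are the image of \<open>\<sigma>\<close> and the kernel of \<open>\<xi>\<close>.\<close>
  define S where "S y = \<sigma> y ` carrier K" for y
  define T where "T y = {v \<in> carrier (vspace V y). \<xi> y v = \<zero>\<^bsub>K\<^esub>}" for y
  have I: "is_subrep K Q (identity_rep K) (\<lambda>y. carrier K)" "is_subrep K Q (identity_rep K) (\<lambda>y. {\<zero>\<^bsub>K\<^esub>})"
    using scalar_space_vectorspace[OF K] by (auto simp: is_subrep_def intro!: subspaceI)
  have sub: "is_subrep K Q V S" "is_subrep K Q V T"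
    unfolding S_def T_def
    using image_is_subrep[OF Q \<sigma> I(1)] preimage_is_subrep[OF Vr Q \<xi> I(2)] by simp_all
  have sum: "module.submodule_sum (vspace V y) (S y) (T y) = carrier (vspace V y) \<and>
      S y \<inter> T y = {\<zero>\<^bsub>vspace V y\<^esub>}" if y: "y \<in> verts Q" for y
  proof
    interpret Vy: vectorspace K "vspace V y" using is_repD(1)[OF Vr y] .
    show "Vy.submodule_sum (S y) (T y) = carrier (vspace V y)"
    proof (intro equalityI subsetI)
      show "v \<in> carrier (vspace V y)" if "v \<in> Vy.submodule_sum (S y) (T y)" for v
        using that s(3)[OF y] by (auto simp: Vy.submodule_sum_def S_def T_def)
      fix v assume v: "v \<in> carrier (vspace V y)"
      let ?u = "\<sigma> y (\<xi> y v)"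
      have u: "?u \<in> carrier (vspace V y)" "?u \<in> S y" using s(3)[OF y] x(3)[OF y v] by (auto simp: S_def)
      have "\<xi> y (v \<ominus>\<^bsub>vspace V y\<^esub> ?u) = \<xi> y v \<ominus>\<^bsub>scalar_space K\<^esub> \<xi> y ?u"
        using linear_mapD(7)[OF rep_homD(1)[OF \<xi> y] v u(1)] by simp
      also have "\<dots> = \<zero>\<^bsub>K\<^esub>"
      proof -
        interpret sc: vectorspace K "scalar_space K" by (rule scalar_space_vectorspace[OF K])
        show ?thesis using id[OF y x(3)[OF y v]] x(3)[OF y v] sc.M.r_neg[of "\<xi> y v"]
          by (simp add: sc.M.minus_eq)
      qed
      finally have "v \<ominus>\<^bsub>vspace V y\<^esub> ?u \<in> T y" using v u by (simp add: T_def)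
      moreover have "v = ?u \<oplus>\<^bsub>vspace V y\<^esub> (v \<ominus>\<^bsub>vspace V y\<^esub> ?u)"
        using v u(1) by (simp add: Vy.M.minus_eq Vy.M.a_lcomm[of ?u v] Vy.M.r_neg)
      ultimately show "v \<in> Vy.submodule_sum (S y) (T y)"
        using u(2) unfolding Vy.submodule_sum_def
        by (intro image_eqI[where x = "(?u, v \<ominus>\<^bsub>vspace V y\<^esub> ?u)"]) (simp_all only: prod.case mem_Collect_eq simp_thms)
    qed
    show "S y \<inter> T y = {\<zero>\<^bsub>vspace V y\<^esub>}"
    proof (intro equalityI subsetI)
      fix v assume v: "v \<in> S y \<inter> T y"
      then obtain k where k: "k \<in> carrier K" "v = \<sigma> y k" by (auto simp: S_def)
      then have "k = \<zero>\<^bsub>K\<^esub>" using v id[OF y k(1)] by (simp add: T_def)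
      then show "v \<in> {\<zero>\<^bsub>vspace V y\<^esub>}" using k s(6)[OF y] by simp
    next
      have "subspace K (S y) (vspace V y)" "subspace K (T y) (vspace V y)"
        using sub y by (simp_all add: is_subrep_def)
      then show "v \<in> S y \<inter> T y" if "v \<in> {\<zero>\<^bsub>vspace V y\<^esub>}" for v
        using that subspaceD(3) by blast
    qed
  qed
  have "\<not> zero_rep Q (sub_rep V S)"
  proof
    assume "zero_rep Q (sub_rep V S)"
    then have "\<sigma> r \<one>\<^bsub>K\<^esub> = \<zero>\<^bsub>vspace V r\<^esub>"
      using r(1) by (auto simp: zero_rep_def sub_rep_def S_def)
    then show False using x(6)[OF r(1)] r(2) by simp
  qed
  then have "zero_rep Q (sub_rep V T)"
    using V sub sum unfolding indecomposable_rep_def by blast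
  then have T: "T y = {\<zero>\<^bsub>vspace V y\<^esub>}" if "y \<in> verts Q" for y
    using that by (simp add: zero_rep_def sub_rep_def)
  have "bij_betw (\<xi> y) (carrier (vspace V y)) (carrier K)" if y: "y \<in> verts Q" for y
  proof -
    have "inj_on (\<xi> y) (carrier (vspace V y))"
      by (rule linear_map_inj_onI[OF rep_homD(1)[OF \<xi> y]]) (use T[OF y] in \<open>auto simp: T_def\<close>)
    moreover have "k \<in> \<xi> y ` carrier (vspace V y)" if "k \<in> carrier K" for k
      using id[OF y that] s(3)[OF y that] by force
    ultimately show ?thesis using x(3)[OF y] by (auto simp: bij_betw_def)
  qed
  then show ?thesis using \<xi> unfolding rep_iso_def by auto
qed

lemma global_tensor_indecomposable:
  assumes K: "field K" and Q: "fin_digraph Q" and T: "tree_quiver Q"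
    and V: "indecomposable_rep K Q V"
  shows "\<not> zero_rep Q (global_tensor K Q V) \<longleftrightarrow> rep_iso K Q V (identity_rep K)"
proof
  interpret fin_digraph Q by fact
  have wf: "wf_digraph Q" ..
  have Vr: "is_rep K Q V" using V by (simp add: indecomposable_rep_def)
  {
    assume "\<not> zero_rep Q (global_tensor K Q V)"
    then obtain r v where r: "r \<in> verts Q" and v: "v \<in> epi_part K Q V r" "v \<notin> mono_kernel K Q V r"
      unfolding zero_global_tensor_iff[OF Vr Q] by blast
    have vc: "v \<in> carrier (vspace V r)" using epi_part_subset[OF Vr Q r] v by blast
    obtain \<sigma> where \<sigma>: "rep_hom K Q (identity_rep K) V \<sigma>" "\<sigma> r \<one>\<^bsub>K\<^esub> = v"
      by (rule hom_from_identity_rep[OF K Q T Vr r v(1)])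
    obtain \<xi> where \<xi>: "rep_hom K Q V (identity_rep K) \<xi>" "\<xi> r v = \<one>\<^bsub>K\<^esub>"
      by (rule hom_to_identity_rep[OF K Q T Vr r vc v(2)])
    show "rep_iso K Q V (identity_rep K)"
      using indecomposable_iso_identity_rep[OF K wf _ V \<sigma>(1) \<xi>(1) r] \<sigma>(2) \<xi>(2) T
      by (simp add: tree_quiver_def)
  }
  assume i: "rep_iso K Q V (identity_rep K)"
  note em = iso_identity_rep_epi_mono[OF Vr wf i]
  have "carrier (vspace V x) \<subseteq> {\<zero>\<^bsub>vspace V x\<^esub>} \<longleftrightarrow> carrier (vspace V x) = {\<zero>\<^bsub>vspace V x\<^esub>}"
    if "x \<in> verts Q" for x
    using mono_kernel_zero[OF Vr Q that] mono_kernel_monomorphic[OF Vr Q em(2) that]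
      carrier_is_subrep[OF Vr] subspaceD(3) that unfolding is_subrep_def by blast
  moreover have "\<not> zero_rep Q V" using V by (simp add: indecomposable_rep_def)
  ultimately show "\<not> zero_rep Q (global_tensor K Q V)"
    using epi_part_epimorphic[OF Vr Q em(1)] mono_kernel_monomorphic[OF Vr Q em(2)]
    unfolding zero_global_tensor_iff[OF Vr Q] unfolding zero_rep_def by simp
qed


section \<open>Direct sums\<close>

lemma dsum_space_simps [simp]:
  "carrier (dsum_space J M) = (\<Pi>\<^sub>E j \<in> J. carrier (M j))"
  "\<zero>\<^bsub>dsum_space J M\<^esub> = (\<lambda>j\<in>J. \<zero>\<^bsub>M j\<^esub>)"
  "f \<oplus>\<^bsub>dsum_space J M\<^esub> g = (\<lambda>j\<in>J. f j \<oplus>\<^bsub>M j\<^esub> g j)"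
  "c \<odot>\<^bsub>dsum_space J M\<^esub> f = (\<lambda>j\<in>J. c \<odot>\<^bsub>M j\<^esub> f j)"
  by (simp_all add: dsum_space_def)

lemma dsum_rep_simps [simp]:
  "vspace (dsum_rep J F) x = dsum_space J (\<lambda>j. vspace (F j) x)"
  "vmap (dsum_rep J F) a f = (\<lambda>j\<in>J. vmap (F j) a (f j))"
  by (simp_all add: dsum_rep_def)

lemma dsum_proj_linear:
  assumes "vectorspace K (dsum_space J M)" "j \<in> J" "vectorspace K (M j)"
  shows "linear_map K (dsum_space J M) (M j) (\<lambda>f. f j)"
  using assms by (intro linear_mapI) auto

text \<open>The inclusion of the summand \<open>j\<close>.\<close>

definition dsum_single :: "'j set \<Rightarrow> ('j \<Rightarrow> ('k, 'v) module) \<Rightarrow> 'j \<Rightarrow> 'v \<Rightarrow> 'j \<Rightarrow> 'v" where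
  "dsum_single J M j v = (\<lambda>i\<in>J. if i = j then v else \<zero>\<^bsub>M i\<^esub>)"

lemma dsum_single_linear:
  assumes D: "vectorspace K (dsum_space J M)" and j: "j \<in> J"
    and M: "\<And>i. i \<in> J \<Longrightarrow> vectorspace K (M i)"
  shows "linear_map K (M j) (dsum_space J M) (dsum_single J M j)"
proof -
  have "\<zero>\<^bsub>M i\<^esub> \<in> carrier (M i)" "\<zero>\<^bsub>M i\<^esub> \<oplus>\<^bsub>M i\<^esub> \<zero>\<^bsub>M i\<^esub> = \<zero>\<^bsub>M i\<^esub>"
    "k \<in> carrier K \<Longrightarrow> k \<odot>\<^bsub>M i\<^esub> \<zero>\<^bsub>M i\<^esub> = \<zero>\<^bsub>M i\<^esub>" if "i \<in> J" for i k
  proof -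
    interpret vectorspace K "M i" using M[OF that] .
    show "\<zero>\<^bsub>M i\<^esub> \<in> carrier (M i)" "\<zero>\<^bsub>M i\<^esub> \<oplus>\<^bsub>M i\<^esub> \<zero>\<^bsub>M i\<^esub> = \<zero>\<^bsub>M i\<^esub>"
      "k \<in> carrier K \<Longrightarrow> k \<odot>\<^bsub>M i\<^esub> \<zero>\<^bsub>M i\<^esub> = \<zero>\<^bsub>M i\<^esub>" by auto
  qed
  then show ?thesis
    by (intro linear_mapI[OF M[OF j] D]) (auto simp: dsum_single_def fun_eq_iff)
qed

text \<open>
  In a finite direct sum an element is the sum of its components, so a subspace containing the
  components contains the element.
\<close>

lemma dsum_mem_subspace:
  assumes J: "finite J" and M: "\<And>j. j \<in> J \<Longrightarrow> vectorspace K (M j)"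
    and T: "subspace K T (dsum_space J M)" and f: "f \<in> carrier (dsum_space J M)"
    and s: "\<And>j. j \<in> J \<Longrightarrow> dsum_single J M j (f j) \<in> T"
  shows "f \<in> T"
proof -
  note S = subspaceD[OF T]
  have fin: "(\<lambda>j\<in>J. if j \<in> F then f j else \<zero>\<^bsub>M j\<^esub>) \<in> T" if "finite F" "F \<subseteq> J" for F
    using that
  proof (induction F rule: finite_induct)
    case empty
    then show ?case using S(3) by (simp add: restrict_def)
  next
    case (insert i F)
    let ?g = "\<lambda>j\<in>J. if j \<in> F then f j else \<zero>\<^bsub>M j\<^esub>"
    have add: "\<zero>\<^bsub>M j\<^esub> \<oplus>\<^bsub>M j\<^esub> v = v" "v \<oplus>\<^bsub>M j\<^esub> \<zero>\<^bsub>M j\<^esub> = v"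
      "\<zero>\<^bsub>M j\<^esub> \<oplus>\<^bsub>M j\<^esub> \<zero>\<^bsub>M j\<^esub> = \<zero>\<^bsub>M j\<^esub>"
      if "j \<in> J" "v \<in> carrier (M j)" for j v
    proof -
      interpret vectorspace K "M j" using M[OF that(1)] .
      show "\<zero>\<^bsub>M j\<^esub> \<oplus>\<^bsub>M j\<^esub> v = v" "v \<oplus>\<^bsub>M j\<^esub> \<zero>\<^bsub>M j\<^esub> = v"
        "\<zero>\<^bsub>M j\<^esub> \<oplus>\<^bsub>M j\<^esub> \<zero>\<^bsub>M j\<^esub> = \<zero>\<^bsub>M j\<^esub>"
        using that by auto
    qed
    have fc: "f j \<in> carrier (M j)" if "j \<in> J" for j using f that by auto
    have "?g \<oplus>\<^bsub>dsum_space J M\<^esub> dsum_single J M i (f i) \<in> T"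
      by (rule S(4)[OF insert.IH s]) (use insert.prems in auto)
    moreover have "?g \<oplus>\<^bsub>dsum_space J M\<^esub> dsum_single J M i (f i)
        = (\<lambda>j\<in>J. if j \<in> insert i F then f j else \<zero>\<^bsub>M j\<^esub>)"
      using insert.hyps add(1,2) add(3)[OF _ fc] fc by (auto simp: dsum_single_def fun_eq_iff)
    ultimately show ?case by (simp only:)
  qed
  have "(\<lambda>j\<in>J. if j \<in> J then f j else \<zero>\<^bsub>M j\<^esub>) = f"
    using f by (auto simp: fun_eq_iff PiE_def extensional_def)
  then show ?thesis using fin[OF J subset_refl] by simp
qed

lemma dsum_restrict_linear:
  assumes D: "vectorspace K (dsum_space J M)" and J': "J' \<subseteq> J"
    and M: "\<And>j. j \<in> J \<Longrightarrow> vectorspace K (M j)"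
  shows "linear_map K (dsum_space J M) (dsum_space J' M) (\<lambda>f. restrict f J')"
    and "(\<lambda>f. restrict f J') ` carrier (dsum_space J M) = carrier (dsum_space J' M)"
proof -
  have z: "\<zero>\<^bsub>M j\<^esub> \<in> carrier (M j)" if "j \<in> J" for j
  proof -
    interpret vectorspace K "M j" using M[OF that] .
    show ?thesis by simp
  qed
  show c: "(\<lambda>f. restrict f J') ` carrier (dsum_space J M) = carrier (dsum_space J' M)"
  proof (intro equalityI subsetI)
    fix g assume g: "g \<in> carrier (dsum_space J' M)"
    have "g = restrict (\<lambda>j\<in>J. if j \<in> J' then g j else \<zero>\<^bsub>M j\<^esub>) J'"
      using g J' by (auto simp: fun_eq_iff PiE_def extensional_def)
    moreover have "(\<lambda>j\<in>J. if j \<in> J' then g j else \<zero>\<^bsub>M j\<^esub>) \<in> carrier (dsum_space J M)"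
      using g J' z by auto
    ultimately show "g \<in> (\<lambda>f. restrict f J') ` carrier (dsum_space J M)" by (rule image_eqI)
  qed (use J' in auto)
  show "linear_map K (dsum_space J M) (dsum_space J' M) (\<lambda>f. restrict f J')"
    by (rule vectorspace_surj(2)[OF D c[symmetric]]) (use J' in \<open>auto simp: fun_eq_iff\<close>)
qed

text \<open>
  The summands with \<open>E \<subseteq> N\<close>, for the maximal epimorphic part \<open>E\<close> and the kernel \<open>N\<close>
  of the maximal monomorphic quotient, do not contribute to the global tensor functor; those that
  are both epimorphic and monomorphic are reproduced.  The projection \<open>\<theta>\<close> of \<open>V\<close> to the latter is
  surjective already on \<open>E\<close>, and its kernel there is \<open>E \<inter> N\<close>.
\<close>

lemma global_tensor_dsum:
  assumes V: "is_rep K Q V" and Q: "fin_digraph Q" and J: "finite J" "J' \<subseteq> J"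
    and F: "\<And>j. j \<in> J \<Longrightarrow> is_rep K Q (F j)"
    and em: "\<And>j. j \<in> J' \<Longrightarrow> epimorphic_rep Q (F j) \<and> monomorphic_rep Q (F j)"
    and zero: "\<And>j. j \<in> J - J' \<Longrightarrow> zero_rep Q (global_tensor K Q (F j))"
    and iso: "rep_iso K Q V (dsum_rep J F)"
  shows "rep_iso K Q (global_tensor K Q V) (dsum_rep J' F)"
proof -
  interpret fin_digraph Q by fact
  have wf: "wf_digraph Q" ..
  let ?W = "dsum_rep J F" and ?W' = "dsum_rep J' F"
  let ?E = "epi_part K Q V" and ?N = "mono_kernel K Q V" and ?M = "mono_quot K Q V"
  obtain \<phi> where \<phi>: "rep_hom K Q V ?W \<phi>"
    and b: "\<And>x. x \<in> verts Q \<Longrightarrow> bij_betw (\<phi> x) (carrier (vspace V x)) (carrier (vspace ?W x))"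
    using iso unfolding rep_iso_def by blast
  define \<phi>' where "\<phi>' x = inv_into (carrier (vspace V x)) (\<phi> x)" for x
  have \<phi>': "rep_hom K Q ?W V \<phi>'"
    using rep_hom_inverse[OF V wf \<phi> b] by (simp add: \<phi>'_def [abs_def])
  have \<phi>'\<phi>: "\<phi>' x (\<phi> x v) = v" if "x \<in> verts Q" "v \<in> carrier (vspace V x)" for x v
    using b[OF that(1)] that(2) by (simp add: \<phi>'_def bij_betw_def)
  have \<phi>\<phi>': "\<phi> x (\<phi>' x f) = f" if "x \<in> verts Q" "f \<in> carrier (vspace ?W x)" for x f
    using b[OF that(1)] that(2) by (simp add: \<phi>'_def bij_betw_def f_inv_into_f)
  have \<phi>c: "\<phi> x v \<in> carrier (vspace ?W x)" if "x \<in> verts Q" "v \<in> carrier (vspace V x)" for x v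
    using linear_mapD(3)[OF rep_homD(1)[OF \<phi>]] that .
  have \<phi>'c: "\<phi>' x f \<in> carrier (vspace V x)" if "x \<in> verts Q" "f \<in> carrier (vspace ?W x)" for x f
    using linear_mapD(3)[OF rep_homD(1)[OF \<phi>']] that .
  have Wvs: "vectorspace K (dsum_space J (\<lambda>j. vspace (F j) x))" if "x \<in> verts Q" for x
    using linear_mapD(2)[OF rep_homD(1)[OF \<phi> that]] by simp
  have Fvs: "vectorspace K (vspace (F j) x)" if "x \<in> verts Q" "j \<in> J" for x j
    using is_repD(1)[OF F] that by blast
  have F0: "vmap (F j) a \<zero>\<^bsub>vspace (F j) (tail Q a)\<^esub> = \<zero>\<^bsub>vspace (F j) (head Q a)\<^esub>"
    if "j \<in> J" "a \<in> arcs Q" for j a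
    using linear_mapD(6)[OF is_repD(3)[OF F]] that .
  have F0c: "\<zero>\<^bsub>vspace (F j) x\<^esub> \<in> carrier (vspace (F j) x)" if "x \<in> verts Q" "j \<in> J" for x j
  proof -
    interpret vectorspace K "vspace (F j) x" using Fvs[OF that] .
    show ?thesis by simp
  qed

  have proj: "rep_hom K Q ?W (F j) (\<lambda>x f. f j)" if "j \<in> J" for j
    using dsum_proj_linear[OF Wvs that] Fvs that by (auto simp: rep_hom_def)
  define \<iota> where "\<iota> j x = dsum_single J (\<lambda>j. vspace (F j) x) j" for j x
  have \<iota>: "rep_hom K Q (F j) ?W (\<iota> j)" if "j \<in> J" for j
    using dsum_single_linear[OF Wvs that Fvs] F0
    by (auto simp: rep_hom_def \<iota>_def dsum_single_def fun_eq_iff)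
  have restr: "rep_hom K Q ?W ?W' (\<lambda>x f. restrict f J')"
    using dsum_restrict_linear(1)[OF Wvs J(2) Fvs] J(2) by (auto simp: rep_hom_def fun_eq_iff)
  define \<theta> where "\<theta> x v = restrict (\<phi> x v) J'" for x v
  have \<theta>: "rep_hom K Q V ?W' \<theta>"
    using rep_hom_comp[OF wf \<phi> restr] by (simp add: \<theta>_def [abs_def])
  have \<theta>c: "\<theta> x v \<in> carrier (vspace ?W' x)" if "x \<in> verts Q" "v \<in> carrier (vspace V x)" for x v
    using linear_mapD(3)[OF rep_homD(1)[OF \<theta>]] that .

  \<comment> \<open>The subrepresentation of \<open>V\<close> corresponding to the summands in \<open>J'\<close> is epimorphic.\<close>
  define S where "S x = {v \<in> carrier (vspace V x).
    \<phi> x v \<in> {f \<in> carrier (vspace ?W x). \<forall>j \<in> J - J'. f j = \<zero>\<^bsub>vspace (F j) x\<^esub>}}" for x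
  have lift: "\<exists>v \<in> S x. \<phi> x v = f"
    if "x \<in> verts Q" "f \<in> carrier (vspace ?W x)" "\<And>j. j \<in> J - J' \<Longrightarrow> f j = \<zero>\<^bsub>vspace (F j) x\<^esub>" for x f
    using that \<phi>\<phi>'[OF that(1,2)] \<phi>'c[OF that(1,2)] by (intro bexI[of _ "\<phi>' x f"]) (auto simp: S_def)
  have Ssub: "is_subrep K Q V S"
  proof -
    have "is_subrep K Q ?W (\<lambda>x. {f \<in> carrier (vspace ?W x). \<forall>j \<in> J - J'. f j = \<zero>\<^bsub>vspace (F j) x\<^esub>})"
      unfolding is_subrep_def
    proof (intro conjI ballI)
      fix x assume x: "x \<in> verts Q"
      have z: "\<zero>\<^bsub>vspace (F j) x\<^esub> \<oplus>\<^bsub>vspace (F j) x\<^esub> \<zero>\<^bsub>vspace (F j) x\<^esub> = \<zero>\<^bsub>vspace (F j) x\<^esub>"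
        "k \<in> carrier K \<Longrightarrow> k \<odot>\<^bsub>vspace (F j) x\<^esub> \<zero>\<^bsub>vspace (F j) x\<^esub> = \<zero>\<^bsub>vspace (F j) x\<^esub>"
        if "j \<in> J" for j k
      proof -
        interpret vectorspace K "vspace (F j) x" using Fvs[OF x that] .
        show "\<zero>\<^bsub>vspace (F j) x\<^esub> \<oplus>\<^bsub>vspace (F j) x\<^esub> \<zero>\<^bsub>vspace (F j) x\<^esub> = \<zero>\<^bsub>vspace (F j) x\<^esub>"
          "k \<in> carrier K \<Longrightarrow> k \<odot>\<^bsub>vspace (F j) x\<^esub> \<zero>\<^bsub>vspace (F j) x\<^esub> = \<zero>\<^bsub>vspace (F j) x\<^esub>" by auto
      qed
      interpret W: vectorspace K "vspace ?W x" using Wvs[OF x] by simp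
      show "subspace K {f \<in> carrier (vspace ?W x). \<forall>j \<in> J - J'. f j = \<zero>\<^bsub>vspace (F j) x\<^esub>} (vspace ?W x)"
      proof (rule subspaceI)
        fix f g assume f: "f \<in> {f \<in> carrier (vspace ?W x). \<forall>j \<in> J - J'. f j = \<zero>\<^bsub>vspace (F j) x\<^esub>}"
          and g: "g \<in> {f \<in> carrier (vspace ?W x). \<forall>j \<in> J - J'. f j = \<zero>\<^bsub>vspace (F j) x\<^esub>}"
        then have "f \<oplus>\<^bsub>vspace ?W x\<^esub> g \<in> carrier (vspace ?W x)" by (intro W.M.a_closed) auto
        then show "f \<oplus>\<^bsub>vspace ?W x\<^esub> g \<in> {f \<in> carrier (vspace ?W x). \<forall>j \<in> J - J'. f j = \<zero>\<^bsub>vspace (F j) x\<^esub>}"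
          using f g z(1) by simp
      next
        fix k f assume k: "k \<in> carrier K"
          and f: "f \<in> {f \<in> carrier (vspace ?W x). \<forall>j \<in> J - J'. f j = \<zero>\<^bsub>vspace (F j) x\<^esub>}"
        then have "k \<odot>\<^bsub>vspace ?W x\<^esub> f \<in> carrier (vspace ?W x)" by (intro W.smult_closed) auto
        then show "k \<odot>\<^bsub>vspace ?W x\<^esub> f \<in> {f \<in> carrier (vspace ?W x). \<forall>j \<in> J - J'. f j = \<zero>\<^bsub>vspace (F j) x\<^esub>}"
          using f z(2) k by simp
      qed (use W.vectorspace_axioms F0c[OF x] in auto)
    next
      fix a assume a: "a \<in> arcs Q"
      show "vmap ?W a ` {f \<in> carrier (vspace ?W (tail Q a)). \<forall>j \<in> J - J'. f j = \<zero>\<^bsub>vspace (F j) (tail Q a)\<^esub>}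
        \<subseteq> {f \<in> carrier (vspace ?W (head Q a)). \<forall>j \<in> J - J'. f j = \<zero>\<^bsub>vspace (F j) (head Q a)\<^esub>}"
        using is_repD(4)[OF F a] F0[OF _ a] by (auto simp: PiE_iff)
    qed
    from preimage_is_subrep[OF V wf \<phi> this] show ?thesis by (simp only: S_def [abs_def])
  qed
  have SE: "S x \<subseteq> ?E x" if "x \<in> verts Q" for x
  proof (rule epi_part_greatestI[OF V Q Ssub _ that], rule subsetI)
    fix a w assume a: "a \<in> arcs Q" and w: "w \<in> S (head Q a)"
    have wc: "w \<in> carrier (vspace V (head Q a))" using w by (simp add: S_def)
    have wF: "\<phi> (head Q a) w j \<in> carrier (vspace (F j) (head Q a))" if "j \<in> J" for j
      using \<phi>c[OF _ wc] a that by auto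
    have "\<exists>u \<in> carrier (vspace (F j) (tail Q a)). vmap (F j) a u = \<phi> (head Q a) w j \<and>
        (j \<notin> J' \<longrightarrow> u = \<zero>\<^bsub>vspace (F j) (tail Q a)\<^esub>)" if j: "j \<in> J" for j
    proof (cases "j \<in> J'")
      case True
      then have "vmap (F j) a ` carrier (vspace (F j) (tail Q a)) = carrier (vspace (F j) (head Q a))"
        using em a by (simp add: epimorphic_rep_def)
      then show ?thesis using True wF[OF j] by (metis imageE)
    next
      case False
      then show ?thesis using w j F0[OF j a] F0c[OF _ j] a
        by (intro bexI[of _ "\<zero>\<^bsub>vspace (F j) (tail Q a)\<^esub>"]) (auto simp: S_def)
    qed
    then obtain u where u: "\<And>j. j \<in> J \<Longrightarrow> u j \<in> carrier (vspace (F j) (tail Q a))"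
      "\<And>j. j \<in> J \<Longrightarrow> vmap (F j) a (u j) = \<phi> (head Q a) w j"
      "\<And>j. j \<in> J \<Longrightarrow> j \<notin> J' \<Longrightarrow> u j = \<zero>\<^bsub>vspace (F j) (tail Q a)\<^esub>" by metis
    have "\<exists>v \<in> S (tail Q a). \<phi> (tail Q a) v = restrict u J"
      by (rule lift) (use a u in auto)
    then obtain v where v: "v \<in> S (tail Q a)" "\<phi> (tail Q a) v = restrict u J" by blast
    have vc: "v \<in> carrier (vspace V (tail Q a))" using v(1) by (simp add: S_def)
    have "\<phi> (head Q a) (vmap V a v) = \<phi> (head Q a) w"
    proof
      fix j
      show "\<phi> (head Q a) (vmap V a v) j = \<phi> (head Q a) w j"
        using rep_homD(2)[OF \<phi> a vc] v(2) u(2)[of j] \<phi>c[OF _ wc] a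
        by (cases "j \<in> J") (auto simp: PiE_def extensional_def)
    qed
    then have "vmap V a v = w"
      using \<phi>'\<phi>[of "head Q a"] is_repD(4)[OF V a vc] wc a by (metis head_in_verts)
    then show "w \<in> vmap V a ` S (tail Q a)" using v(1) by blast
  qed
  have surj: "\<theta> x ` ?E x = carrier (vspace ?W' x)" if x: "x \<in> verts Q" for x
  proof (intro equalityI subsetI)
    fix g assume g: "g \<in> carrier (vspace ?W' x)"
    let ?f = "\<lambda>j\<in>J. if j \<in> J' then g j else \<zero>\<^bsub>vspace (F j) x\<^esub>"
    have "\<exists>v \<in> S x. \<phi> x v = ?f"
      by (rule lift[OF x]) (use g J(2) F0c[OF x] in auto)
    then obtain v where v: "v \<in> S x" "\<phi> x v = ?f" by blast
    have "\<theta> x v = g" using v(2) g J(2) by (auto simp: \<theta>_def fun_eq_iff PiE_def extensional_def)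
    then show "g \<in> \<theta> x ` ?E x" using v(1) SE[OF x] by blast
  qed (use \<theta>c[OF x] epi_part_subset[OF V Q x] in blast)

  have W'lin: "linear_map K (vspace ?W' (tail Q a)) (vspace ?W' (head Q a)) (vmap ?W' a)"
    if a: "a \<in> arcs Q" for a
  proof (rule linear_mapI)
    have j: "linear_map K (vspace (F j) (tail Q a)) (vspace (F j) (head Q a)) (vmap (F j) a)"
      if "j \<in> J'" for j
      using is_repD(3)[OF F a, of j] that J(2) by blast
    show "vectorspace K (vspace ?W' (tail Q a))" "vectorspace K (vspace ?W' (head Q a))"
      using linear_mapD(2)[OF rep_homD(1)[OF \<theta>]] a by auto
    show "vmap ?W' a f \<in> carrier (vspace ?W' (head Q a))" if "f \<in> carrier (vspace ?W' (tail Q a))" for f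
      using that linear_mapD(3)[OF j] by (auto simp: PiE_iff)
    show "vmap ?W' a (f \<oplus>\<^bsub>vspace ?W' (tail Q a)\<^esub> g) = vmap ?W' a f \<oplus>\<^bsub>vspace ?W' (head Q a)\<^esub> vmap ?W' a g"
      if "f \<in> carrier (vspace ?W' (tail Q a))" "g \<in> carrier (vspace ?W' (tail Q a))" for f g
      using that linear_mapD(4)[OF j] by (auto simp: PiE_iff fun_eq_iff)
    show "vmap ?W' a (k \<odot>\<^bsub>vspace ?W' (tail Q a)\<^esub> f) = k \<odot>\<^bsub>vspace ?W' (head Q a)\<^esub> vmap ?W' a f"
      if "k \<in> carrier K" "f \<in> carrier (vspace ?W' (tail Q a))" for k f
      using that linear_mapD(5)[OF j] by (auto simp: PiE_iff fun_eq_iff)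
  qed
  have \<theta>surj: "\<theta> x ` carrier (vspace V x) = carrier (vspace ?W' x)" if x: "x \<in> verts Q" for x
    using surj[OF x] \<theta>c[OF x] epi_part_subset[OF V Q x] by blast
  have W': "is_rep K Q ?W'"
    unfolding is_rep_def
  proof (intro conjI ballI)
    fix x assume x: "x \<in> verts Q"
    interpret linear_map K "vspace V x" "vspace ?W' x" "\<theta> x" using rep_homD(1)[OF \<theta> x] .
    show "vectorspace K (vspace ?W' x)" using linear_mapD(2)[OF rep_homD(1)[OF \<theta> x]] .
    show "vectorspace.fin_dim K (vspace ?W' x)"
      using rank_nullity_main(2)[OF is_repD(2)[OF V x] \<theta>surj[OF x]] .
  qed (rule W'lin)
  have W'mono: "monomorphic_rep Q ?W'"
    unfolding monomorphic_rep_def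
  proof (intro ballI inj_onI)
    fix a f g assume a: "a \<in> arcs Q" and f: "f \<in> carrier (vspace ?W' (tail Q a))"
      and g: "g \<in> carrier (vspace ?W' (tail Q a))" and e: "vmap ?W' a f = vmap ?W' a g"
    show "f = g"
    proof (rule PiE_ext)
      show "f \<in> (\<Pi>\<^sub>E j \<in> J'. carrier (vspace (F j) (tail Q a)))"
        "g \<in> (\<Pi>\<^sub>E j \<in> J'. carrier (vspace (F j) (tail Q a)))" using f g by simp_all
      fix j assume j: "j \<in> J'"
      have "vmap (F j) a (f j) = vmap (F j) a (g j)" using fun_cong[OF e, of j] j by simp
      then show "f j = g j"
        using em[OF j] a f g j by (auto simp: monomorphic_rep_def PiE_iff dest: inj_onD)
    qed
  qed

  \<comment> \<open>The kernel of \<open>\<theta>\<close> on the maximal epimorphic part.\<close>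
  have ker: "v \<in> ?N x"
    if x: "x \<in> verts Q" and v: "v \<in> ?E x" and z: "\<theta> x v = \<zero>\<^bsub>vspace ?W' x\<^esub>" for x v
  proof -
    have vc: "v \<in> carrier (vspace V x)" using v epi_part_subset[OF V Q x] by blast
    have Nx: "subspace K (?N x) (vspace V x)"
      using mono_quot_universal(1)[OF V Q] x by (simp add: is_subrep_def)
    have comp: "\<phi>' x (\<iota> j x (\<phi> x v j)) \<in> ?N x" if j: "j \<in> J" for j
    proof -
      have E: "\<phi> x v j \<in> epi_part K Q (F j) x"
        using epi_part_hom[OF V F[OF j] Q rep_hom_comp[OF wf \<phi> proj[OF j]] x v] .
      have "\<phi> x v j \<in> mono_kernel K Q (F j) x"
      proof (cases "j \<in> J'")
        case True
        then have "\<phi> x v j = \<zero>\<^bsub>vspace (F j) x\<^esub>" using fun_cong[OF z, of j] by (simp add: \<theta>_def)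
        then show ?thesis using mono_kernel_zero[OF F[OF j] Q x] by simp
      next
        case False
        then show ?thesis using E zero[of j] j x unfolding zero_global_tensor_iff[OF F[OF j] Q] by blast
      qed
      then show ?thesis
        using mono_kernel_hom[OF F[OF j] V Q rep_hom_comp[OF wf \<iota>[OF j] \<phi>']] by blast
    qed
    have "\<phi> x v \<in> {f \<in> carrier (vspace ?W x). \<phi>' x f \<in> ?N x}"
    proof (rule dsum_mem_subspace[OF J(1), of K "\<lambda>j. vspace (F j) x"])
      show "subspace K {f \<in> carrier (vspace ?W x). \<phi>' x f \<in> ?N x} (dsum_space J (\<lambda>j. vspace (F j) x))"
        using preimage_subspace[OF rep_homD(1)[OF \<phi>' x] Nx] by simp
      show "\<phi> x v \<in> carrier (dsum_space J (\<lambda>j. vspace (F j) x))" using \<phi>c[OF x vc] by simp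
      fix j assume j: "j \<in> J"
      show "vectorspace K (vspace (F j) x)" using Fvs[OF x j] .
      have "\<phi> x v j \<in> carrier (vspace (F j) x)" using \<phi>c[OF x vc] j by auto
      then have "\<iota> j x (\<phi> x v j) \<in> carrier (vspace ?W x)"
        by (rule linear_mapD(3)[OF rep_homD(1)[OF \<iota>[OF j] x]])
      then show "dsum_single J (\<lambda>j. vspace (F j) x) j (\<phi> x v j) \<in> {f \<in> carrier (vspace ?W x). \<phi>' x f \<in> ?N x}"
        using comp[OF j] by (simp add: \<iota>_def)
    qed
    then show ?thesis using \<phi>'\<phi>[OF x vc] by simp
  qed

  obtain \<psi> where \<psi>: "rep_hom K Q ?M ?W' \<psi>"
    "\<And>x v. x \<in> verts Q \<Longrightarrow> v \<in> carrier (vspace V x) \<Longrightarrow> \<psi> x (quot_proj V ?N x v) = \<theta> x v"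
    using mono_quot_universal(3)[OF V Q W' W'mono \<theta> \<theta>surj] by blast
  let ?R = "global_tensor K Q V"
  have Rsub: "is_subrep K Q ?M (\<lambda>x. carrier (vspace ?R x))"
    using global_tensor_subrep[OF V Q] by (simp add: carrier_global_tensor)
  have Rx: "vspace ?R x = (vspace ?M x)\<lparr>carrier := carrier (vspace ?R x)\<rparr>" for x
    by (simp add: global_tensor_def sub_rep_def)
  have Ra: "vmap ?R a = vmap ?M a" for a by (simp add: global_tensor_def sub_rep_def)
  have lin: "linear_map K (vspace ?R x) (vspace ?W' x) (\<psi> x)" if x: "x \<in> verts Q" for x
  proof -
    have "subspace K (carrier (vspace ?R x)) (vspace ?M x)" using Rsub x by (simp add: is_subrep_def)
    from restrict_linear_map[OF rep_homD(1)[OF \<psi>(1) x] this] show ?thesis by (subst Rx)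
  qed
  have "rep_hom K Q ?R ?W' \<psi>"
    unfolding rep_hom_def
  proof (intro conjI ballI)
    fix a A assume a: "a \<in> arcs Q" and A: "A \<in> carrier (vspace ?R (tail Q a))"
    have "subspace K (carrier (vspace ?R (tail Q a))) (vspace ?M (tail Q a))"
      using Rsub a by (simp add: is_subrep_def)
    then have "A \<in> carrier (vspace ?M (tail Q a))" using A subspaceD(2) by blast
    then show "\<psi> (head Q a) (vmap ?R a A) = vmap ?W' a (\<psi> (tail Q a) A)"
      unfolding Ra by (rule rep_homD(2)[OF \<psi>(1) a])
  qed (rule lin)
  moreover have "bij_betw (\<psi> x) (carrier (vspace ?R x)) (carrier (vspace ?W' x))" if x: "x \<in> verts Q" for x
  proof -
    have c: "v \<in> carrier (vspace V x)" if "v \<in> ?E x" for v using that epi_part_subset[OF V Q x] by blast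
    have "\<psi> x ` carrier (vspace ?R x) = \<theta> x ` ?E x"
      using \<psi>(2)[OF x c] by (auto simp: carrier_global_tensor image_image)
    moreover have "inj_on (\<psi> x) (carrier (vspace ?R x))"
    proof (rule linear_map_inj_onI[OF lin[OF x]])
      fix A assume "A \<in> carrier (vspace ?R x)" and z: "\<psi> x A = \<zero>\<^bsub>vspace ?W' x\<^esub>"
      then obtain v where v: "v \<in> ?E x" "A = quot_proj V ?N x v" by (auto simp: carrier_global_tensor)
      then have "v \<in> ?N x" using ker[OF x v(1)] z \<psi>(2)[OF x c[OF v(1)]] by simp
      then have "A = \<zero>\<^bsub>vspace ?M x\<^esub>"
        using v quot_proj_eq_zero_iff[OF V Q mono_quot_universal(1)[OF V Q] x c[OF v(1)]]
        by (simp add: mono_quot_def)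
      then show "A = \<zero>\<^bsub>vspace ?R x\<^esub>" by (simp add: global_tensor_def sub_rep_def)
    qed
    ultimately show ?thesis using surj[OF x] by (simp add: bij_betw_def)
  qed
  ultimately show ?thesis unfolding rep_iso_def by blast
qed


theorem mainTheorem3:
  fixes K :: "('k, 'm) ring_scheme"
    and Q :: "('q, 'e) pre_digraph"
    and V :: "('q, 'e, 'k, 'v) quiver_rep"
    and J :: "'j set"
    and S :: "'j \<Rightarrow> 'q \<Rightarrow> 'v set"
  assumes "field K" and "fin_digraph Q" and "tree_quiver Q"
  shows
    "(indecomposable_rep K Q V \<longrightarrow>
        (\<not> zero_rep Q (global_tensor K Q V) \<longleftrightarrow> rep_iso K Q V (identity_rep K)))
     \<and>
     (is_rep K Q V \<and> finite J \<and>
      (\<forall>j \<in> J. is_subrep K Q V (S j) \<and> indecomposable_rep K Q (sub_rep V (S j))) \<and>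
      rep_iso K Q V (dsum_rep J (\<lambda>j. sub_rep V (S j))) \<longrightarrow>
        rep_iso K Q (global_tensor K Q V)
          (dsum_rep {j \<in> J. rep_iso K Q (sub_rep V (S j)) (identity_rep K)}
             (\<lambda>j. sub_rep V (S j))))"
proof (intro conjI impI)
  assume "indecomposable_rep K Q V"
  then show "\<not> zero_rep Q (global_tensor K Q V) \<longleftrightarrow> rep_iso K Q V (identity_rep K)"
    by (rule global_tensor_indecomposable[OF assms])
next
  assume "is_rep K Q V \<and> finite J \<and>
    (\<forall>j \<in> J. is_subrep K Q V (S j) \<and> indecomposable_rep K Q (sub_rep V (S j))) \<and>
    rep_iso K Q V (dsum_rep J (\<lambda>j. sub_rep V (S j)))"
  then have V: "is_rep K Q V" and J: "finite J"
    and ind: "\<And>j. j \<in> J \<Longrightarrow> indecomposable_rep K Q (sub_rep V (S j))"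
    and iso: "rep_iso K Q V (dsum_rep J (\<lambda>j. sub_rep V (S j)))" by auto
  have rep: "is_rep K Q (sub_rep V (S j))" if "j \<in> J" for j
    using ind[OF that] by (simp add: indecomposable_rep_def)
  have wf: "wf_digraph Q" using assms(2) by (simp add: fin_digraph_def)
  show "rep_iso K Q (global_tensor K Q V)
      (dsum_rep {j \<in> J. rep_iso K Q (sub_rep V (S j)) (identity_rep K)} (\<lambda>j. sub_rep V (S j)))"
  proof (rule global_tensor_dsum[OF V assms(2) J _ rep _ _ iso])
    fix j assume j: "j \<in> {j \<in> J. rep_iso K Q (sub_rep V (S j)) (identity_rep K)}"
    then show "epimorphic_rep Q (sub_rep V (S j)) \<and> monomorphic_rep Q (sub_rep V (S j))"
      using iso_identity_rep_epi_mono[OF rep wf] by blast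
  next
    fix j assume "j \<in> J - {j \<in> J. rep_iso K Q (sub_rep V (S j)) (identity_rep K)}"
    then show "zero_rep Q (global_tensor K Q (sub_rep V (S j)))"
      using global_tensor_indecomposable[OF assms ind] by blast
  qed blast
qed

end
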